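(* Let $X$ be a complex Banach space which is $q$-uniformly convex for some $q\ge2$ and let $T=P_N\cdots P_1$, where $P_1,\dots,P_N\in\mathcal{B}(X)$ are orthoprojections. Let $M=\operatorname{Ran}P_1\cap\dots\cap\operatorname{Ran}P_N$ and let $Z$ denote the closure of $\operatorname{Ran}(I-T)$. Then $X=M\oplus Z$, the projection $P$ onto $M$ along $Z$ is an orthoprojection, and for all $x\in X$ we have $$\|T^nx-Px\|\to0,\quad n\to\infty.\qquad( * )$$ Moreover: (i) if $\operatorname{Ran}(I-T)$ is closed, then there exist $C>0$ and $r\in[0,1)$ such that $\|T^n-P\|\le Cr^n$ for all $n\ge0$; (ii) if $\operatorname{Ran}(I-T)$ is not closed, then the convergence in $( * )$ is arbitrarily slow and weakly arbitrarily slow; (iii) in either case there exists a dense subspace $X_0$ of $X$ such that for all $x\in X_0$ the convergence in $( * )$ is superpolynomially fast.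
   Context: $\mathcal{B}(X)$ is the algebra of bounded linear operators on $X$ and $\operatorname{Ran}$ denotes range. An *orthoprojection* on $X$ is an operator $P\in\mathcal{B}(X)$ with $P^2=P$ and $\|P\|\le1$. The modulus of convexity of $X$ is $$\delta_X(\varepsilon)=\inf\Big\{1-\tfrac{\|x+y\|}{2}:\|x\|\le1,\ \|y\|\le1,\ \|x-y\|\ge\varepsilon\Big\},\quad 0\le\varepsilon\le2.$$ For $q\ge2$, $X$ is *$q$-uniformly convex* if there exists $c>0$ such that $\delta_X(\varepsilon)\ge c\varepsilon^q$ for all $\varepsilon\in[0,2]$. Let $T_n\in\mathcal{B}(X)$, $n\ge0$, satisfy $\|T_nx\|\to0$ as $n\to\infty$ for all $x\in X$. The convergence is *arbitrarily slow* if for every sequence $(r_n)_{n\ge0}$ of non-negative scalars with $r_n\to0$ there exists $x\in X$ such that $\|T_nx\|\ge r_n$ for all $n\ge0$. It is *weakly arbitrarily slow* if for every such sequence $(r_n)_{n\ge0}$ there exist $x\in X$ and $\phi\in X^*$ such that $\operatorname{Re}\langle T_nx,\phi\rangle\ge r_n$ for all $n\ge0$, where $\langle x,\phi\rangle=\phi(x)$. It is *superpolynomially fast* for a particular $x\in X$ if $\|T_nx\|=o(n^{-k})$ as $n\to\infty$ for all $k\ge1$. For the convergence in $( * )$ these notions are applied with $T_n=T^n-P$. *)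

theory Defs
  imports "HOL-Analysis.Analysis" "HOL-Library.Landau_Symbols"
begin

class complex_normed_vector = real_normed_vector +
  fixes scaleC :: "complex \<Rightarrow> 'a \<Rightarrow> 'a" (infixr "*\<^sub>C" 75)
  assumes scaleC_add_right: "a *\<^sub>C (x + y) = a *\<^sub>C x + a *\<^sub>C y"
    and scaleC_add_left: "(a + b) *\<^sub>C x = a *\<^sub>C x + b *\<^sub>C x"
    and scaleC_scaleC: "a *\<^sub>C (b *\<^sub>C x) = (a * b) *\<^sub>C x"
    and scaleC_one: "1 *\<^sub>C x = x"
    and scaleR_scaleC: "r *\<^sub>R x = complex_of_real r *\<^sub>C x"
    and norm_scaleC: "norm (a *\<^sub>C x) = cmod a * norm x"

class complex_banach = complex_normed_vector + banach

instantiation complex :: complex_banach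
begin

definition scaleC_complex :: "complex \<Rightarrow> complex \<Rightarrow> complex"
  where "scaleC_complex a x = a * x"

instance
  by standard
    (simp_all add: scaleC_complex_def distrib_left distrib_right norm_mult scaleR_conv_of_real)

end

lemma vector_space_scaleC:
  "vector_space (scaleC :: complex \<Rightarrow> 'a \<Rightarrow> 'a::complex_normed_vector)"
  by unfold_locales (simp_all add: scaleC_add_right scaleC_add_left scaleC_scaleC scaleC_one)

abbreviation csubspace :: "'a::complex_normed_vector set \<Rightarrow> bool"
  where "csubspace \<equiv> module.subspace scaleC"

text \<open>The operator norm is the library's \<^const>\<open>onorm\<close>; it does not depend on the scalar field.\<close>

definition bounded_clinear ::
    "('a::complex_normed_vector \<Rightarrow> 'b::complex_normed_vector) \<Rightarrow> bool"
  where "bounded_clinear f \<longleftrightarrow>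
    bounded_linear f \<and> Vector_Spaces.linear scaleC scaleC f"

definition orthoprojection :: "('a::complex_normed_vector \<Rightarrow> 'a) \<Rightarrow> bool"
  where "orthoprojection P \<longleftrightarrow> bounded_clinear P \<and> P \<circ> P = P \<and> onorm P \<le> 1"

text \<open>\<^term>\<open>comp_upto P n\<close> is the product \<open>P n \<circ> \<dots> \<circ> P 1\<close>, with \<open>P 1\<close> applied first.\<close>

primrec comp_upto :: "(nat \<Rightarrow> 'a \<Rightarrow> 'a) \<Rightarrow> nat \<Rightarrow> 'a \<Rightarrow> 'a"
  where
    "comp_upto P 0 = id"
  | "comp_upto P (Suc n) = P (Suc n) \<circ> comp_upto P n"

text \<open>The infimum is taken in the extended reals, so that the infimum over the empty set
  (which occurs only for the zero space) is \<open>\<infinity>\<close>.\<close>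

definition modulus_of_convexity :: "'a::real_normed_vector itself \<Rightarrow> real \<Rightarrow> ereal"
  where "modulus_of_convexity _ \<epsilon> =
    Inf {ereal (1 - norm (x + y) / 2) | x y :: 'a. norm x \<le> 1 \<and> norm y \<le> 1 \<and> norm (x - y) \<ge> \<epsilon>}"

definition q_uniformly_convex :: "'a::real_normed_vector itself \<Rightarrow> real \<Rightarrow> bool"
  where "q_uniformly_convex X q \<longleftrightarrow>
    (\<exists>c>0. \<forall>\<epsilon>\<in>{0..2}. modulus_of_convexity X \<epsilon> \<ge> ereal (c * \<epsilon> powr q))"

definition direct_sum_decomposition :: "'a::complex_normed_vector set \<Rightarrow> 'a set \<Rightarrow> bool"
  where "direct_sum_decomposition M Z \<longleftrightarrow>
    csubspace M \<and> csubspace Z \<and> closed M \<and> closed Z \<and>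
    M \<inter> Z = {0} \<and> (\<forall>x. \<exists>m\<in>M. \<exists>z\<in>Z. x = m + z)"

definition projection_along :: "'a::complex_normed_vector set \<Rightarrow> 'a set \<Rightarrow> 'a \<Rightarrow> 'a"
  where "projection_along M Z x = (THE m. m \<in> M \<and> x - m \<in> Z)"

definition arbitrarily_slow :: "(nat \<Rightarrow> 'a::complex_normed_vector \<Rightarrow> 'a) \<Rightarrow> bool"
  where "arbitrarily_slow S \<longleftrightarrow>
    (\<forall>r :: nat \<Rightarrow> real. (\<forall>n. r n \<ge> 0) \<longrightarrow> r \<longlonglongrightarrow> 0 \<longrightarrow> (\<exists>x. \<forall>n. norm (S n x) \<ge> r n))"

definition weakly_arbitrarily_slow :: "(nat \<Rightarrow> 'a::complex_normed_vector \<Rightarrow> 'a) \<Rightarrow> bool"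
  where "weakly_arbitrarily_slow S \<longleftrightarrow>
    (\<forall>r :: nat \<Rightarrow> real. (\<forall>n. r n \<ge> 0) \<longrightarrow> r \<longlonglongrightarrow> 0 \<longrightarrow>
      (\<exists>x. \<exists>\<phi> :: 'a \<Rightarrow> complex. bounded_clinear \<phi> \<and> (\<forall>n. Re (\<phi> (S n x)) \<ge> r n)))"

definition superpolynomially_fast_at ::
    "(nat \<Rightarrow> 'a::complex_normed_vector \<Rightarrow> 'a) \<Rightarrow> 'a \<Rightarrow> bool"
  where "superpolynomially_fast_at S x \<longleftrightarrow>
    (\<forall>k::nat. k \<ge> 1 \<longrightarrow> (\<lambda>n. norm (S n x)) \<in> o(\<lambda>n. 1 / real n ^ k))"

end

theory Submission
  imports Defs
begin

text \<open>Write \<open>s = 1/q\<close>. For \<open>\<parallel>x\<parallel> \<le> 1\<close>, comparing \<open>x\<close> with \<open>P\<^sub>i x\<close> in the modulus of convexity gives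
  \<open>c \<parallel>x - P\<^sub>i x\<parallel>^q \<le> \<parallel>x\<parallel> - \<parallel>P\<^sub>i x\<parallel>\<close>, because \<open>\<parallel>x + P\<^sub>i x\<parallel> \<ge> \<parallel>P\<^sub>i (x + P\<^sub>i x)\<parallel> = 2 \<parallel>P\<^sub>i x\<parallel>\<close>. Chaining
  the \<open>N\<close> factors bounds \<open>\<parallel>x - T x\<parallel>\<close> by a multiple of \<open>(\<parallel>x\<parallel> - \<parallel>T x\<parallel>)^s\<close>, so the fixed space of
  \<open>T\<close> is \<open>M\<close> and \<open>\<parallel>T^n (I - T)\<parallel> = O(n^(-s))\<close>. Every coset of \<open>Z\<close> has a unique element of
  minimal norm, which \<open>T\<close> must fix; hence \<open>X = M + Z\<close>.

  If the range of \<open>I - T\<close> is closed, it equals \<open>Z\<close>, so \<open>n^s T^n\<close> is pointwise bounded on \<open>Z\<close>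
  and by uniform boundedness some power of \<open>T\<close> is a strict contraction there. Vectors with
  superpolynomial decay come from a Mittag-Leffler construction of elements near a given
  \<open>z \<in> Z\<close> that lie in the range of every \<open>(I - T)^k\<close>.

  If the range is not closed, \<open>Z\<close> contains unit vectors \<open>u\<close> with \<open>T u - u\<close> arbitrarily small. One
  chooses vectors \<open>u\<^sub>k\<close> and functionals \<open>f\<^sub>k\<close>, almost fixed by \<open>T\<close> and its adjoint for times up
  to \<open>m\<^sub>k\<close>, where at time \<open>m\<^sub>k\<close> all earlier \<open>u\<^sub>j\<close> and \<open>f\<^sub>j\<close> have already died out. The cross
  terms \<open>f\<^sub>j (T^n u\<^sub>k)\<close> are then negligible at all times, and with slowly decaying
  geometric weights \<open>x = \<Sum>i. \<theta>^i u\<^sub>i\<close> and \<open>\<phi> = \<Sum>i. \<theta>^i f\<^sub>i\<close> decay as slowly as desired.\<close>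

section \<open>Norm drop in uniformly convex spaces\<close>

text \<open>The vectors \<open>x\<close> and \<open>y\<close> themselves compete in the infimum for
  \<open>norm (x - y)\<close>, which lies in \<open>{0..2}\<close>; dividing by \<open>R\<close>
  carries the resulting inequality to balls of any radius.\<close>

lemma q_uniformly_convex_scaled:
  assumes "q_uniformly_convex TYPE('a::real_normed_vector) q"
  obtains c where "c > 0"
    and "\<And>(x::'a) y R. norm x \<le> R \<Longrightarrow> norm y \<le> R \<Longrightarrow> R > 0 \<Longrightarrow>
           c * (norm (x - y) / R) powr q \<le> 1 - norm (x + y) / (2 * R)"
proof -
  obtain c where c: "c > 0"
    and mod: "\<And>\<epsilon>. \<epsilon> \<in> {0..2} \<Longrightarrow> ereal (c * \<epsilon> powr q) \<le> modulus_of_convexity TYPE('a) \<epsilon>"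
    using assms unfolding q_uniformly_convex_def by blast
  have unit: "c * norm (x - y) powr q \<le> 1 - norm (x + y) / 2"
    if "norm x \<le> 1" "norm y \<le> 1" for x y :: 'a
  proof -
    have "norm (x - y) \<in> {0..2}"
      using norm_triangle_ineq4[of x y] that by auto
    then have "ereal (c * norm (x - y) powr q) \<le> modulus_of_convexity TYPE('a) (norm (x - y))"
      by (rule mod)
    also have "\<dots> \<le> ereal (1 - norm (x + y) / 2)"
      unfolding modulus_of_convexity_def by (rule Inf_lower) (use that in blast)
    finally show ?thesis by simp
  qed
  have "c * (norm (x - y) / R) powr q \<le> 1 - norm (x + y) / (2 * R)"
    if "norm x \<le> R" "norm y \<le> R" "R > 0" for x y :: 'a and R
  proof -
    have nrm: "norm (v /\<^sub>R R) = norm v / R" for v :: 'a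
      unfolding norm_scaleR divide_inverse using \<open>R > 0\<close> by simp
    have "c * norm (x /\<^sub>R R - y /\<^sub>R R) powr q \<le> 1 - norm (x /\<^sub>R R + y /\<^sub>R R) / 2"
      by (rule unit) (use that nrm in auto)
    then have "c * norm ((x - y) /\<^sub>R R) powr q \<le> 1 - norm ((x + y) /\<^sub>R R) / 2"
      by (simp only: scaleR_diff_right scaleR_add_right)
    then show ?thesis
      unfolding nrm by (simp add: mult.commute)
  qed
  with c that show thesis by blast
qed

text \<open>Midpoints stay in \<open>S\<close>, so two nearly minimal elements have a midpoint that
  is not much shorter, and convexity forces them to be close. The nearly minimal elements thus form
  nested closed sets of vanishing diameter. The conclusion is phrased for a competitor such as
  \<open>T y\<close>, known only to be no longer than \<open>y\<close>.\<close>

lemma min_norm_element: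
  fixes S :: "'a::banach set"
  assumes "q_uniformly_convex TYPE('a) q" and "q > 0"
    and "closed S" and "S \<noteq> {}"
    and mid: "\<And>x y. x \<in> S \<Longrightarrow> y \<in> S \<Longrightarrow> (x + y) /\<^sub>R 2 \<in> S"
  obtains y where "y \<in> S" and "\<And>x. x \<in> S \<Longrightarrow> norm x \<le> norm y \<Longrightarrow> x = y"
proof -
  obtain c where c: "c > 0"
    and uc: "\<And>(x::'a) y R. norm x \<le> R \<Longrightarrow> norm y \<le> R \<Longrightarrow> R > 0 \<Longrightarrow>
           c * (norm (x - y) / R) powr q \<le> 1 - norm (x + y) / (2 * R)"
    using q_uniformly_convex_scaled[OF assms(1)] by blast
  define d where "d = Inf (norm ` S)"
  have d: "d \<le> norm x" if "x \<in> S" for x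
    unfolding d_def using that by (intro cINF_lower bdd_belowI[of _ 0]) auto
  have d0: "d \<ge> 0"
    unfolding d_def using \<open>S \<noteq> {}\<close> by (intro cINF_greatest) auto
  have ex: "\<exists>x\<in>S. norm x < d + e" if "e > 0" for e
    using \<open>S \<noteq> {}\<close> that cInf_lessD[of "norm ` S" "d + e"] unfolding d_def by auto
  have gap: "c * (norm (x - y) / R) powr q \<le> 1 - d / R"
    if "x \<in> S" "y \<in> S" "norm x \<le> R" "norm y \<le> R" "R > 0" for x y R
  proof -
    have "d \<le> norm (x + y) / 2"
      using d[OF mid[OF that(1,2)]] by simp
    then have "d / R \<le> norm (x + y) / (2 * R)"
      using \<open>R > 0\<close> by (simp add: field_simps)
    with uc[OF that(3-5)] show ?thesis by linarith
  qed
  have small: "\<exists>n. \<forall>x\<in>S \<inter> cball 0 (d + 1 / Suc n). \<forall>y\<in>S \<inter> cball 0 (d + 1 / Suc n). dist x y < e"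
    if "e > 0" for e
  proof -
    define R where "R n = d + 1 / Suc n" for n :: nat
    have Rpos: "R n > 0" for n
      unfolding R_def using d0 by (simp add: add_nonneg_pos)
    have "(\<lambda>n. R n - d) \<longlonglongrightarrow> 0"
      unfolding R_def using LIMSEQ_inverse_real_of_nat by (simp add: inverse_eq_divide)
    then have Rd: "R \<longlonglongrightarrow> d" by (simp add: LIM_zero_cancel)
    \<comment> \<open>If \<open>d = 0\<close>, the ball itself shrinks to a point. Otherwise
      \<open>1 - d / R n\<close> tends to \<open>0\<close>, while the convexity gap for distance
      \<open>e\<close> tends to a positive limit.\<close>
    have "\<exists>n. 2 * R n < e \<or> 1 - d / R n < c * (e / R n) powr q"
    proof (cases "d = 0")
      case True
      with Rd have "(\<lambda>n. 2 * R n) \<longlonglongrightarrow> 0" using tendsto_mult_right_zero by blast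
      then have "eventually (\<lambda>n. 2 * R n < e) sequentially"
        using \<open>e > 0\<close> by (rule order_tendstoD)
      then show ?thesis by (auto simp: eventually_sequentially)
    next
      case False
      then have "(\<lambda>n. c * (e / R n) powr q - (1 - d / R n)) \<longlonglongrightarrow> c * (e / d) powr q - (1 - d / d)"
        using \<open>e > 0\<close> by (intro tendsto_intros Rd) auto
      moreover have "c * (e / d) powr q - (1 - d / d) > 0"
        using False d0 c \<open>e > 0\<close> by simp
      ultimately have "eventually (\<lambda>n. c * (e / R n) powr q - (1 - d / R n) > 0) sequentially"
        by (rule order_tendstoD)
      then show ?thesis by (auto simp: eventually_sequentially)
    qed
    then obtain n where n: "2 * R n < e \<or> 1 - d / R n < c * (e / R n) powr q" by blast
    have "dist x y < e" if "x \<in> S" "y \<in> S" "norm x \<le> R n" "norm y \<le> R n" for x y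
    proof (rule ccontr)
      assume "\<not> dist x y < e"
      then have xy: "e \<le> norm (x - y)" by (simp add: dist_norm)
      then have "(e / R n) powr q \<le> (norm (x - y) / R n) powr q"
        using \<open>q > 0\<close> \<open>e > 0\<close> Rpos[of n] by (intro powr_mono2 divide_right_mono) auto
      then have "c * (e / R n) powr q \<le> 1 - d / R n"
        using gap[OF that Rpos] c by (meson mult_left_mono less_imp_le order_trans)
      moreover have "e \<le> 2 * R n"
        using xy norm_triangle_ineq4[of x y] that by linarith
      ultimately show False using n by linarith
    qed
    then show ?thesis unfolding R_def by (intro exI[of _ n]) auto
  qed
  obtain y where y: "\<And>n. y \<in> S \<inter> cball 0 (d + 1 / Suc n)"
  proof (rule decreasing_closed_nest[of "\<lambda>n. S \<inter> cball 0 (d + 1 / Suc n)"])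
    show "closed (S \<inter> cball 0 (d + 1 / Suc n))" for n
      using \<open>closed S\<close> by auto
    show "S \<inter> cball 0 (d + 1 / Suc n) \<noteq> {}" for n
      using ex[of "1 / Suc n"] by (auto intro: less_imp_le)
    show "S \<inter> cball 0 (d + 1 / Suc n) \<subseteq> S \<inter> cball 0 (d + 1 / Suc m)" if "m \<le> n" for m n
    proof -
      have "1 / real (Suc n) \<le> 1 / real (Suc m)"
        using that by (intro divide_left_mono) auto
      then show ?thesis by auto
    qed
    show "\<exists>n. \<forall>x\<in>S \<inter> cball 0 (d + 1 / Suc n). \<forall>y\<in>S \<inter> cball 0 (d + 1 / Suc n). dist x y < e"
      if "e > 0" for e using small[OF that] .
  qed blast
  have "x = y" if "x \<in> S" "norm x \<le> norm y" for x
  proof -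
    have "dist x y < e" if "e > 0" for e
      proof -
      obtain n where n: "\<forall>x\<in>S \<inter> cball 0 (d + 1 / Suc n). \<forall>y\<in>S \<inter> cball 0 (d + 1 / Suc n). dist x y < e"
        using small[OF \<open>e > 0\<close>] by blast
      have "x \<in> S \<inter> cball 0 (d + 1 / Suc n)"
        using y[of n] \<open>x \<in> S\<close> \<open>norm x \<le> norm y\<close> by auto
      with n y[of n] show ?thesis by blast
    qed
    then show ?thesis by (metis dist_nz less_irrefl)
  qed
  with y that show thesis by blast
qed

text \<open>Working on the ball of radius \<open>norm x\<close> instead of the unit ball yields the
  drop \<open>norm x - norm (P x)\<close> in place of the weaker
  \<open>1 - norm (P x)\<close>.\<close>

lemma contractive_projection_norm_drop:
  fixes P :: "'a::real_normed_vector \<Rightarrow> 'a"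
  assumes uc: "\<And>(x::'a) y R. norm x \<le> R \<Longrightarrow> norm y \<le> R \<Longrightarrow> R > 0 \<Longrightarrow>
           c * (norm (x - y) / R) powr q \<le> 1 - norm (x + y) / (2 * R)"
    and "c > 0" and "q \<ge> 1"
    and "linear P" and idem: "\<And>x. P (P x) = P x" and contr: "\<And>x. norm (P x) \<le> norm x"
    and "norm x \<le> 1"
  shows "c * norm (x - P x) powr q \<le> norm x - norm (P x)"
proof (cases "x = 0")
  case True
  then show ?thesis using \<open>linear P\<close> by (simp add: linear_0)
next
  case False
  define R where "R = norm x"
  have R: "R > 0" "R \<le> 1" using False \<open>norm x \<le> 1\<close> by (auto simp: R_def)
  have "2 * norm (P x) = norm (P (x + P x))"
    using idem by (simp add: linear_add[OF \<open>linear P\<close>] flip: scaleR_2)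
  also have "\<dots> \<le> norm (x + P x)" by (rule contr)
  finally have half: "norm (P x) / R \<le> norm (x + P x) / (2 * R)"
    using R by (simp add: field_simps)
  have "c * (norm (x - P x) / R) powr q \<le> 1 - norm (x + P x) / (2 * R)"
    using uc[of x R "P x"] contr R by (simp add: R_def)
  with half have "c * (norm (x - P x) / R) powr q \<le> 1 - norm (P x) / R" by linarith
  then have "c * (norm (x - P x) / R) powr q * R \<le> (1 - norm (P x) / R) * R"
    using R by (intro mult_right_mono) auto
  also have "\<dots> = norm x - norm (P x)" using R by (simp add: R_def field_simps)
  finally have *: "c * (norm (x - P x) / R) powr q * R \<le> norm x - norm (P x)" .
  \<comment> \<open>Since \<open>R\<close> is at most \<open>1\<close> and \<open>q\<close> at least
    \<open>1\<close>, the factor \<open>R / R powr q\<close> left by the rescaling is at least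
    \<open>1\<close> and may be dropped.\<close>
  have "R powr q \<le> R powr 1" using R \<open>q \<ge> 1\<close> by (intro powr_mono') auto
  then have "norm (x - P x) powr q \<le> norm (x - P x) powr q / R powr q * R"
    using R mult_right_mono[of "R powr q" R "norm (x - P x) powr q"]
    by (simp add: pos_le_divide_eq mult.commute)
  also have "\<dots> = (norm (x - P x) / R) powr q * R" using R by (simp add: powr_divide)
  finally have "c * norm (x - P x) powr q \<le> c * ((norm (x - P x) / R) powr q * R)"
    using \<open>c > 0\<close> by (intro mult_left_mono) auto
  with * show ?thesis by (simp add: mult.assoc)
qed

text \<open>Norms decrease along the product, so the displacement at each factor is controlled by
  the total drop, and \<open>n\<close> factors cost only the factor \<open>n\<close>.\<close>

lemma comp_upto_norm_drop:
  fixes Ps :: "nat \<Rightarrow> 'a::real_normed_vector \<Rightarrow> 'a"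
  assumes "c > 0" and "q > 0"
    and drop: "\<And>i x. i \<in> {1..N} \<Longrightarrow> norm x \<le> 1 \<Longrightarrow>
                  c * norm (x - Ps i x) powr q \<le> norm x - norm (Ps i x)"
    and contr: "\<And>i x. i \<in> {1..N} \<Longrightarrow> norm (Ps i x) \<le> norm x"
    and "norm x \<le> 1" and "n \<le> N"
  shows "norm (comp_upto Ps n x) \<le> norm x \<and>
    norm (x - comp_upto Ps n x) \<le> n * ((norm x - norm (comp_upto Ps n x)) / c) powr (1 / q)"
  using \<open>n \<le> N\<close>
proof (induction n)
  case 0
  then show ?case by simp
next
  case (Suc n)
  define y where "y = comp_upto Ps n x"
  have IH: "norm y \<le> norm x" "norm (x - y) \<le> n * ((norm x - norm y) / c) powr (1 / q)"
    using Suc by (auto simp: y_def)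
  have i: "Suc n \<in> {1..N}" using Suc by auto
  have y1: "norm y \<le> 1" using IH \<open>norm x \<le> 1\<close> by linarith
  have le: "norm (Ps (Suc n) y) \<le> norm y" using contr[OF i] .
  define D where "D = ((norm x - norm (Ps (Suc n) y)) / c) powr (1 / q)"
  have "norm (y - Ps (Suc n) y) powr q \<le> (norm y - norm (Ps (Suc n) y)) / c"
    using drop[OF i y1] \<open>c > 0\<close> by (simp add: field_simps)
  also have "\<dots> \<le> (norm x - norm (Ps (Suc n) y)) / c"
    using IH \<open>c > 0\<close> by (simp add: divide_right_mono)
  finally have "(norm (y - Ps (Suc n) y) powr q) powr (1 / q) \<le> D"
    unfolding D_def using \<open>q > 0\<close> by (intro powr_mono2) auto
  then have 1: "norm (y - Ps (Suc n) y) \<le> D" using \<open>q > 0\<close> by (simp add: powr_powr)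
  have "((norm x - norm y) / c) powr (1 / q) \<le> D"
    unfolding D_def using \<open>q > 0\<close> \<open>c > 0\<close> IH le by (intro powr_mono2 divide_right_mono) auto
  then have 2: "norm (x - y) \<le> n * D" using IH(2) by (meson mult_left_mono of_nat_0_le_iff order_trans)
  have "norm (x - Ps (Suc n) y) \<le> norm (x - y) + norm (y - Ps (Suc n) y)"
    using norm_triangle_ineq[of "x - y" "y - Ps (Suc n) y"] by simp
  also have "\<dots> \<le> Suc n * D" using 1 2 by (simp add: algebra_simps)
  finally show ?case using IH le by (simp add: y_def[symmetric] D_def)
qed

text \<open>If no norm is lost in total, none is lost at any stage. Each partial product then fixes
  \<open>x\<close>, and the norm drop for the next factor vanishes at \<open>x\<close>
  itself.\<close>

lemma comp_upto_fixed_point: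
  fixes Ps :: "nat \<Rightarrow> 'a::real_normed_vector \<Rightarrow> 'a"
  assumes "c > 0" and "q > 0"
    and drop: "\<And>i x. i \<in> {1..N} \<Longrightarrow> norm x \<le> 1 \<Longrightarrow>
                  c * norm (x - Ps i x) powr q \<le> norm x - norm (Ps i x)"
    and contr: "\<And>i x. i \<in> {1..N} \<Longrightarrow> norm (Ps i x) \<le> norm x"
    and "norm x \<le> 1" and "n \<le> N" and "norm (comp_upto Ps n x) = norm x" and "i \<in> {1..n}"
  shows "Ps i x = x"
  using assms(6-8)
proof (induction n)
  case 0
  then show ?case by simp
next
  case (Suc n)
  have n: "n \<le> N" "Suc n \<in> {1..N}" using Suc.prems by auto
  note D = comp_upto_norm_drop[of c q N Ps x n, OF assms(1-5) n(1)]
  have "norm x \<le> norm (comp_upto Ps n x)"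
    using contr[OF n(2), of "comp_upto Ps n x"] Suc.prems(2) by simp
  with D have eq: "norm (comp_upto Ps n x) = norm x" by simp
  with D \<open>q > 0\<close> have fixed: "comp_upto Ps n x = x" by simp
  then have "c * norm (x - Ps (Suc n) x) powr q \<le> 0"
    using drop[OF n(2) \<open>norm x \<le> 1\<close>] Suc.prems(2) by simp
  then have "Ps (Suc n) x = x"
    using \<open>c > 0\<close> by (simp add: mult_le_0_iff powr_def split: if_splits)
  with Suc.IH[OF n(1) eq] Suc.prems(3) show ?case
    by (cases "i = Suc n") auto
qed

lemma funpow_norm_le:
  fixes T :: "'a::real_normed_vector \<Rightarrow> 'a"
  assumes "\<And>x. norm (T x) \<le> norm x"
  shows "norm ((T ^^ n) x) \<le> norm x"
  by (induction n) (auto intro: order_trans[OF assms])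

lemma linear_funpow:
  fixes T :: "'a::real_vector \<Rightarrow> 'a"
  assumes "linear T"
  shows "linear (T ^^ n)"
proof (induction n)
  case 0
  show ?case unfolding funpow.simps id_def by (rule linear_ident)
next
  case (Suc n)
  show ?case unfolding funpow.simps by (rule linear_compose[OF Suc assms])
qed

text \<open>For \<open>\<parallel>x\<parallel> \<le> 1\<close> one of the first \<open>n + 1\<close> steps lowers the norm by at most \<open>1/(n + 1)\<close>, hence
  has a small difference, and the differences \<open>T^j (x - T x)\<close> only get smaller.\<close>

lemma decay_of_differences:
  fixes T :: "'a::real_normed_vector \<Rightarrow> 'a"
  assumes "linear T" and contr: "\<And>x. norm (T x) \<le> norm x" and "c > 0" and "s > 0" and "K \<ge> 0"
    and drop: "\<And>x. norm x \<le> 1 \<Longrightarrow> norm (x - T x) \<le> K * ((norm x - norm (T x)) / c) powr s"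
  shows "norm ((T ^^ n) (x - T x)) \<le> K / c powr s * norm x / real (Suc n) powr s"
proof -
  have unit: "norm ((T ^^ n) (x - T x)) \<le> K / c powr s / real (Suc n) powr s" if "norm x \<le> 1" for x
  proof -
    define d where "d j = norm ((T ^^ j) x) - norm ((T ^^ Suc j) x)" for j
    have "\<exists>j\<le>n. d j \<le> 1 / real (Suc n)"
    proof (rule ccontr)
      assume "\<not> ?thesis"
      then have "(\<Sum>j\<le>n. 1 / real (Suc n)) < (\<Sum>j\<le>n. d j)"
        by (intro sum_strict_mono) auto
      also have "\<dots> = norm x - norm ((T ^^ Suc n) x)"
        unfolding d_def by (subst sum_telescope) simp
      finally show False using that by (simp add: divide_simps) (smt (verit) norm_ge_zero)
    qed
    then obtain j where j: "j \<le> n" "d j \<le> 1 / real (Suc n)" by blast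
    have lin: "linear (T ^^ j)" for j using linear_funpow[OF \<open>linear T\<close>] .
    have "(T ^^ n) (x - T x) = (T ^^ (n - j)) ((T ^^ j) (x - T x))"
      using j(1) by (metis funpow_add comp_apply le_add_diff_inverse2)
    then have "norm ((T ^^ n) (x - T x)) \<le> norm ((T ^^ j) (x - T x))"
      using funpow_norm_le[of T, OF contr] by metis
    also have "(T ^^ j) (x - T x) = (T ^^ j) x - T ((T ^^ j) x)"
      by (simp add: linear_diff[OF lin] funpow_swap1)
    also have "norm \<dots> \<le> K * (d j / c) powr s"
      unfolding d_def using drop[of "(T ^^ j) x"] funpow_norm_le[of T j x, OF contr] that by simp
    also have "\<dots> \<le> K * (1 / real (Suc n) / c) powr s"
      using j \<open>c > 0\<close> \<open>s > 0\<close> \<open>K \<ge> 0\<close> contr[of "(T ^^ j) x"]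
      by (intro mult_left_mono powr_mono2 divide_right_mono) (auto simp: d_def)
    also have "\<dots> = K / c powr s / real (Suc n) powr s"
      using \<open>c > 0\<close> by (simp add: powr_divide powr_mult)
    finally show ?thesis .
  qed
  show ?thesis
  proof (cases "x = 0")
    case True
    then show ?thesis
      using linear_0[OF linear_funpow[OF \<open>linear T\<close>]] linear_0[OF \<open>linear T\<close>] by simp
  next
    case False
    define y where "y = x /\<^sub>R norm x"
    have "norm ((T ^^ n) (y - T y)) \<le> K / c powr s / real (Suc n) powr s"
      by (rule unit) (simp add: y_def False)
    moreover have "(T ^^ n) (y - T y) = (T ^^ n) (x - T x) /\<^sub>R norm x"
      unfolding y_def
      by (simp add: linear_cmul[OF \<open>linear T\<close>] linear_cmul[OF linear_funpow[OF \<open>linear T\<close>]] flip: scaleR_diff_right)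
    ultimately show ?thesis using False by (simp add: field_simps)
  qed
qed

section \<open>Contractions with asymptotically vanishing differences\<close>

lemma bounded_linear_of_linear_le:
  fixes f :: "'a::real_normed_vector \<Rightarrow> 'b::real_normed_vector"
  assumes "linear f" and "\<And>x. norm (f x) \<le> K * norm x"
  shows "bounded_linear f"
  using assms(2)
  by (intro bounded_linear_intro[of f K])
    (auto simp: linear_add[OF assms(1)] linear_cmul[OF assms(1)] mult.commute)

lemma subspace_closure:
  fixes S :: "'a::real_normed_vector set"
  assumes "subspace S"
  shows "subspace (closure S)"
proof (rule subspaceI)
  show "0 \<in> closure S"
    using subspace_0[OF assms] closure_subset by blast
next
  fix x y assume "x \<in> closure S" "y \<in> closure S"
  then obtain f g where "\<And>n. f n \<in> S" "f \<longlonglongrightarrow> x" "\<And>n. g n \<in> S" "g \<longlonglongrightarrow> y"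
    unfolding closure_sequential by blast
  then show "x + y \<in> closure S"
    unfolding closure_sequential
    by (intro exI[of _ "\<lambda>n. f n + g n"]) (auto intro: tendsto_add subspace_add[OF assms])
next
  fix c x assume "x \<in> closure S"
  then obtain f where "\<And>n. f n \<in> S" "f \<longlonglongrightarrow> x"
    unfolding closure_sequential by blast
  then show "c *\<^sub>R x \<in> closure S"
    unfolding closure_sequential
    by (intro exI[of _ "\<lambda>n. c *\<^sub>R f n"]) (auto intro: tendsto_intros subspace_scale[OF assms])
qed

text \<open>This isolates what the asymptotic arguments use: uniform convexity enters only through
  \<open>decay\<close> and the splitting given by \<open>P\<close>. The map \<open>P\<close> is a
  mere choice of a fixed point in each coset; its linearity and contractivity are derived by
  recognising it as the pointwise limit of the powers of \<open>T\<close>.\<close>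

locale regular_contraction =
  fixes T P :: "'a::banach \<Rightarrow> 'a" and C s :: real
  assumes lin: "linear T"
    and contr: "\<And>x. norm (T x) \<le> norm x"
    and decay: "\<And>n x. norm ((T ^^ n) (x - T x)) \<le> C * norm x / real (Suc n) powr s"
    and s_pos: "s > 0" and C_nonneg: "C \<ge> 0"
    and T_P: "\<And>x. T (P x) = P x"
    and compl: "\<And>x. x - P x \<in> closure (range (\<lambda>x. x - T x))"
begin

definition Z :: "'a set" where "Z = closure (range (\<lambda>x. x - T x))"

lemma lin_pow: "linear (T ^^ n)"
  by (rule linear_funpow[OF lin])

lemma norm_pow_le: "norm ((T ^^ n) x) \<le> norm x"
  by (rule funpow_norm_le[OF contr])

lemma pow_diff: "(T ^^ n) (x - y) = (T ^^ n) x - (T ^^ n) y"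
  by (rule linear_diff[OF lin_pow])

lemma pow_pow: "(T ^^ m) ((T ^^ n) x) = (T ^^ (m + n)) x"
  by (simp add: funpow_add)

lemma norm_pow_antimono: "m \<le> n \<Longrightarrow> norm ((T ^^ n) x) \<le> norm ((T ^^ m) x)"
  using norm_pow_le[of "n - m" "(T ^^ m) x"] by (simp add: pow_pow)

lemma bl: "bounded_linear T"
  using bounded_linear_of_linear_le[OF lin, of 1] contr by simp

lemma bl_pow: "bounded_linear (T ^^ n)"
  using bounded_linear_of_linear_le[OF lin_pow, of n 1] norm_pow_le by simp

lemma weight_tendsto: "(\<lambda>n. K / real (Suc n) powr s) \<longlonglongrightarrow> 0"
proof -
  have "filterlim (\<lambda>n. real (Suc n)) at_top sequentially"
    by (rule filterlim_compose[OF filterlim_real_sequentially filterlim_Suc])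
  then have "(\<lambda>n. real (Suc n) powr - s) \<longlonglongrightarrow> 0"
    using s_pos by (intro tendsto_neg_powr) auto
  then have "(\<lambda>n. K * real (Suc n) powr - s) \<longlonglongrightarrow> 0"
    by (rule tendsto_mult_right_zero)
  then show ?thesis by (simp add: powr_minus divide_inverse)
qed

lemma subspace_Z: "subspace Z"
proof -
  have "linear (\<lambda>x. x - T x)"
    using linear_compose_sub[OF linear_ident lin] .
  then show ?thesis
    unfolding Z_def by (intro subspace_closure linear_subspace_image subspace_UNIV)
qed

lemma closed_Z: "closed Z"
  by (simp add: Z_def)

lemma range_subset_Z: "x - T x \<in> Z"
  unfolding Z_def by (rule subsetD[OF closure_subset rangeI])

lemma diff_pow_in_Z: "x - (T ^^ n) x \<in> Z"
proof (induction n)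
  case 0
  then show ?case using subspace_0[OF subspace_Z] by simp
next
  case (Suc n)
  have "(x - (T ^^ n) x) + ((T ^^ n) x - T ((T ^^ n) x)) \<in> Z"
    by (rule subspace_add[OF subspace_Z Suc range_subset_Z])
  then show ?case by (simp only: funpow.simps comp_apply add_diff_eq diff_add_cancel)
qed

lemma pow_in_Z:
  assumes "z \<in> Z"
  shows "(T ^^ n) z \<in> Z"
proof -
  have "z - (z - (T ^^ n) z) \<in> Z"
    by (rule subspace_diff[OF subspace_Z assms diff_pow_in_Z])
  then show ?thesis by (simp only: diff_diff_eq2 add_diff_cancel_left')
qed

text \<open>On the range of \<open>I - T\<close> this is \<open>decay\<close>; it passes to the
  closure because all powers are contractions.\<close>

lemma pow_tendsto_0:
  assumes "z \<in> Z"
  shows "(\<lambda>n. (T ^^ n) z) \<longlonglongrightarrow> 0"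
proof (rule LIMSEQ_I)
  fix e :: real assume "e > 0"
  then obtain y where y: "dist (y - T y) z < e / 2"
    using assms half_gt_zero[OF \<open>e > 0\<close>] unfolding Z_def closure_approachable by blast
  have "(\<lambda>n. C * norm y / real (Suc n) powr s) \<longlonglongrightarrow> 0" by (rule weight_tendsto)
  then have "eventually (\<lambda>n. C * norm y / real (Suc n) powr s < e / 2) sequentially"
    using \<open>e > 0\<close> by (intro order_tendstoD) auto
  then obtain m where m: "\<And>n. n \<ge> m \<Longrightarrow> C * norm y / real (Suc n) powr s < e / 2"
    by (auto simp: eventually_sequentially)
  have "norm ((T ^^ n) z) < e" if "n \<ge> m" for n
  proof -
    have "norm ((T ^^ n) z) \<le> norm ((T ^^ n) (y - T y)) + norm ((T ^^ n) (z - (y - T y)))"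
      using norm_triangle_ineq[of "(T ^^ n) (y - T y)" "(T ^^ n) (z - (y - T y))"] by (simp add: pow_diff)
    also have "\<dots> < e / 2 + e / 2"
    proof (rule add_strict_mono)
      show "norm ((T ^^ n) (y - T y)) < e / 2"
        using decay[of n y] m[OF that] by (rule order.strict_trans1)
      show "norm ((T ^^ n) (z - (y - T y))) < e / 2"
        using norm_pow_le[of n "z - (y - T y)"] y by (simp add: dist_norm norm_minus_commute)
    qed
    finally show ?thesis by simp
  qed
  then show "\<exists>m. \<forall>n\<ge>m. norm ((T ^^ n) z - 0) < e" by auto
qed

lemma pow_fixed: "T m = m \<Longrightarrow> (T ^^ n) m = m"
  by (induction n) auto

lemma fixed_in_Z: "T m = m \<Longrightarrow> m \<in> Z \<Longrightarrow> m = 0"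
  using pow_tendsto_0[of m] pow_fixed[of m] by (simp add: LIMSEQ_const_iff)

lemma pow_diff_P: "(T ^^ n) (x - P x) = (T ^^ n) x - P x"
  by (simp add: pow_diff pow_fixed T_P)

lemma diff_P_in_Z: "x - P x \<in> Z"
  using compl by (simp add: Z_def)

lemma pow_tendsto_P: "(\<lambda>n. (T ^^ n) x) \<longlonglongrightarrow> P x"
  using pow_tendsto_0[OF diff_P_in_Z, of x] by (simp add: pow_diff_P LIM_zero_cancel)

lemma P_Z: "z \<in> Z \<Longrightarrow> P z = 0"
  using LIMSEQ_unique[OF pow_tendsto_P pow_tendsto_0] .

lemma P_fixed: "T m = m \<Longrightarrow> P m = m"
  using LIMSEQ_unique[OF pow_tendsto_P, of m m] by (simp add: pow_fixed)

lemma norm_P_le: "norm (P x) \<le> norm x"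
  by (rule LIMSEQ_le_const2[OF tendsto_norm[OF pow_tendsto_P]]) (use norm_pow_le in blast)

lemma lin_P: "linear P"
proof (rule linearI)
  fix x y :: 'a and r :: real
  have "(\<lambda>n. (T ^^ n) x + (T ^^ n) y) \<longlonglongrightarrow> P x + P y"
    by (intro tendsto_add pow_tendsto_P)
  then show "P (x + y) = P x + P y"
    using LIMSEQ_unique[OF pow_tendsto_P] by (simp add: linear_add[OF lin_pow])
  have "(\<lambda>n. r *\<^sub>R (T ^^ n) x) \<longlonglongrightarrow> r *\<^sub>R P x"
    by (intro tendsto_intros pow_tendsto_P)
  then show "P (r *\<^sub>R x) = r *\<^sub>R P x"
    using LIMSEQ_unique[OF pow_tendsto_P] by (simp add: linear_cmul[OF lin_pow])
qed

lemma bl_P: "bounded_linear P"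
  using bounded_linear_of_linear_le[OF lin_P, of 1] norm_P_le by simp

end

section \<open>Geometric convergence\<close>

text \<open>By Baire's theorem one of the closed sets \<open>F m\<close> contains a ball, and
  differences of points of that ball, rescaled, reach every vector.\<close>

lemma uniform_boundedness:
  fixes f :: "nat \<Rightarrow> 'a::banach \<Rightarrow> 'b::real_normed_vector"
  assumes bl: "\<And>n. bounded_linear (f n)"
    and bdd: "\<And>x. \<exists>K. \<forall>n. norm (f n x) \<le> K"
  obtains K where "K \<ge> 0" and "\<And>n x. norm (f n x) \<le> K * norm x"
proof -
  define F where "F m = {x. \<forall>n. norm (f n x) \<le> real m}" for m
  have "closed (F m)" for m
  proof -
    have "F m = (\<Inter>n. {x. norm (f n x) \<le> real m})" by (auto simp: F_def)
    also have "closed \<dots>"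
      using linear_continuous_on[OF bl]
      by (intro closed_INT ballI closed_Collect_le continuous_intros) auto
    finally show ?thesis .
  qed
  moreover have "(\<Union>m. F m) = UNIV"
  proof -
    have "\<exists>m. x \<in> F m" for x
    proof -
      obtain K where "\<And>n. norm (f n x) \<le> K" using bdd by blast
      moreover obtain m :: nat where "K \<le> real m" using real_arch_simple by blast
      ultimately have "x \<in> F m" unfolding F_def using order_trans by blast
      then show ?thesis ..
    qed
    then show ?thesis by blast
  qed
  moreover have "completely_metrizable_space (euclidean :: 'a topology)"
    by (rule completely_metrizable_space_euclidean)
  ultimately obtain m where "interior (F m) \<noteq> {}"
    using Baire_category_alt[of "euclidean :: 'a topology" "range F"] by auto
  then obtain x0 where "x0 \<in> interior (F m)" by blast
  then obtain r where r: "r > 0" "cball x0 r \<subseteq> F m"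
    by (auto simp: mem_interior_cball)
  have "norm (f n x) \<le> 2 * real m / r * norm x" for n x
  proof (cases "x = 0")
    case True
    then show ?thesis using linear_0[OF bounded_linear.linear[OF bl]] by simp
  next
    case False
    define y where "y = (r / norm x) *\<^sub>R x"
    have "x0 + y \<in> F m" "x0 \<in> F m"
      using r False by (auto simp: y_def dist_norm intro!: subsetD[OF r(2)])
    then have "norm (f n (x0 + y)) \<le> real m" "norm (f n x0) \<le> real m" by (auto simp: F_def)
    moreover have "f n y = f n (x0 + y) - f n x0"
      using linear_add[OF bounded_linear.linear[OF bl]] by simp
    ultimately have "norm (f n y) \<le> 2 * real m"
      using norm_triangle_ineq4[of "f n (x0 + y)" "f n x0"] by simp
    moreover have "norm (f n y) = r / norm x * norm (f n x)"
      unfolding y_def using linear_cmul[OF bounded_linear.linear[OF bl]] r by simp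
    ultimately show ?thesis using False r by (simp add: field_simps)
  qed
  with r show thesis by (intro that[of "2 * real m / r"]) auto
qed

context regular_contraction
begin

text \<open>With closed range every vector of \<open>Z\<close> has the form \<open>y - T y\<close>,
  so \<open>decay\<close> bounds the weighted powers at each vector; the uniform bound divided by
  the weight eventually falls below \<open>1 / 2\<close>.\<close>

lemma half_power:
  assumes "closed (range (\<lambda>x. x - T x))"
  obtains m where "m \<ge> 1" and "\<And>z. z \<in> Z \<Longrightarrow> norm ((T ^^ m) z) \<le> norm z / 2"
proof -
  \<comment> \<open>Composing with \<open>I - P\<close> gives operators on the whole space, so
    uniform boundedness applies without treating \<open>Z\<close> as a Banach space of its
    own.\<close>
  define f where "f n x = (real (Suc n) powr s) *\<^sub>R (T ^^ n) (x - P x)" for n x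
  obtain K where K: "\<And>n x. norm (f n x) \<le> K * norm x"
  proof (rule uniform_boundedness[of f])
    show "bounded_linear (f n)" for n
      unfolding f_def
      by (intro bounded_linear_const_scaleR bounded_linear_compose[OF bl_pow] bounded_linear_sub bounded_linear_ident bl_P)
    show "\<exists>K. \<forall>n. norm (f n x) \<le> K" for x
    proof -
      have "x - P x \<in> range (\<lambda>x. x - T x)"
        using diff_P_in_Z assms by (simp add: Z_def)
      then obtain y where y: "x - P x = y - T y" by blast
      have "norm (f n x) \<le> C * norm y" for n
        unfolding f_def y using decay[of n y] by (simp add: field_simps)
      then show ?thesis by blast
    qed
  qed blast
  have "eventually (\<lambda>n. K / real (Suc n) powr s < 1 / 2) sequentially"
    using weight_tendsto by (rule order_tendstoD) simp
  then have "eventually (\<lambda>n. K / real (Suc n) powr s < 1 / 2 \<and> n \<ge> 1) sequentially"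
    using eventually_ge_at_top by (rule eventually_conj)
  from eventually_happens[OF this] obtain m where m: "K / real (Suc m) powr s < 1 / 2" "m \<ge> 1"
    by auto
  have "norm ((T ^^ m) z) \<le> norm z / 2" if "z \<in> Z" for z
  proof -
    have "real (Suc m) powr s * norm ((T ^^ m) z) \<le> K * norm z"
      using K[of m z] by (simp add: f_def P_Z[OF that])
    then have "norm ((T ^^ m) z) \<le> K / real (Suc m) powr s * norm z"
      by (simp add: field_simps)
    also have "\<dots> \<le> 1 / 2 * norm z"
      using m by (intro mult_right_mono) auto
    finally show ?thesis by simp
  qed
  with m that show thesis by blast
qed

lemma geometric_convergence:
  assumes "closed (range (\<lambda>x. x - T x))"
  obtains r where "r \<in> {0..<1}" and "\<And>n x. norm ((T ^^ n) x - P x) \<le> 4 * r ^ n * norm x"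
proof -
  obtain m where m: "m \<ge> 1" and half: "\<And>z. z \<in> Z \<Longrightarrow> norm ((T ^^ m) z) \<le> norm z / 2"
    using half_power[OF assms] by blast
  define r :: real where "r = root m (1 / 2)"
  have r: "r \<ge> 0" "r < 1" "r ^ m = 1 / 2"
    using m by (auto simp: r_def)
  have iter: "norm ((T ^^ (a * m)) z) \<le> (1 / 2) ^ a * norm z" if "z \<in> Z" for a z
  proof (induction a)
    case (Suc a)
    have "norm ((T ^^ (Suc a * m)) z) = norm ((T ^^ m) ((T ^^ (a * m)) z))"
      by (simp add: pow_pow)
    also have "\<dots> \<le> norm ((T ^^ (a * m)) z) / 2"
      by (rule half[OF pow_in_Z[OF that]])
    finally show ?case using Suc by simp
  qed simp
  have "norm ((T ^^ n) x - P x) \<le> 4 * r ^ n * norm x" for n x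
  proof -
    have "norm ((T ^^ n) x - P x) = norm ((T ^^ n) (x - P x))"
      by (simp add: pow_diff_P)
    also have "\<dots> \<le> norm ((T ^^ (n div m * m)) (x - P x))"
      by (rule norm_pow_antimono) simp
    also have "\<dots> \<le> (1 / 2) ^ (n div m) * norm (x - P x)"
      by (rule iter[OF diff_P_in_Z])
    \<comment> \<open>One factor \<open>2\<close> comes from rounding \<open>n\<close> down to a
      multiple of \<open>m\<close>, the other from the norm of \<open>I - P\<close>; together they
      give the constant \<open>4\<close>.\<close>
    also have "\<dots> \<le> (2 * r ^ n) * (2 * norm x)"
    proof (rule mult_mono)
      have "r ^ m \<le> r ^ (n mod m)"
        using r m by (intro power_decreasing) auto
      then have "1 / 2 * (r ^ m) ^ (n div m) \<le> r ^ (n mod m) * (r ^ m) ^ (n div m)"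
        using r by (intro mult_right_mono) auto
      also have "\<dots> = r ^ (n mod m + m * (n div m))"
        by (simp only: power_add power_mult)
      also have "\<dots> = r ^ n" by simp
      finally show "(1 / 2) ^ (n div m) \<le> 2 * r ^ n" using r(3) by simp
      show "norm (x - P x) \<le> 2 * norm x"
        using norm_triangle_ineq4[of x "P x"] norm_P_le[of x] by simp
    qed (use r in auto)
    finally show ?thesis by simp
  qed
  with r that show thesis by (meson atLeastLessThan_iff)
qed

end

section \<open>Superpolynomially fast orbits\<close>

text \<open>An approximate backward orbit \<open>u\<close> is built first, with errors shrinking
  fast enough that pushing \<open>u (j + i)\<close> forward by \<open>B ^^ i\<close> converges as
  \<open>i\<close> grows. The limits satisfy the backward relation exactly.\<close>

lemma dense_backward_orbit:
  fixes B :: "'a::banach \<Rightarrow> 'a"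
  assumes "linear B" and B_le: "\<And>x. norm (B x) \<le> L * norm x" and "L \<ge> 1"
    and dense: "\<And>z e. z \<in> Z \<Longrightarrow> e > 0 \<Longrightarrow> \<exists>y\<in>Z. norm (z - B y) < e"
    and "z \<in> Z" and "e > 0"
  obtains w where "norm (w 0 - z) < e" and "\<And>j. w j = B (w (Suc j))"
proof -
  \<comment> \<open>The power of \<open>L\<close> compensates the growth of \<open>B ^^ k\<close>;
    the power of \<open>2\<close> leaves a geometric series with total \<open>e / 2\<close>.\<close>
  define \<epsilon> where "\<epsilon> k = e / 4 / (2 * L) ^ k" for k :: nat
  have eps: "\<epsilon> k > 0" for k using \<open>e > 0\<close> \<open>L \<ge> 1\<close> by (simp add: \<epsilon>_def)
  have dense': "\<exists>y. y \<in> Z \<and> norm (v - B y) < \<epsilon> k" if "v \<in> Z" for v k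
    using dense[OF that eps] by blast
  have "\<exists>u. \<forall>k. (u k \<in> Z \<and> (k = 0 \<longrightarrow> u k = z)) \<and> norm (u k - B (u (Suc k))) < \<epsilon> k"
    by (rule dependent_nat_choice[where P = "\<lambda>k u. u \<in> Z \<and> (k = 0 \<longrightarrow> u = z)"
          and Q = "\<lambda>k u v. norm (u - B v) < \<epsilon> k"])
      (use \<open>z \<in> Z\<close> dense' in auto)
  then obtain u where u0: "u 0 = z" and u: "\<And>k. norm (u k - B (u (Suc k))) < \<epsilon> k"
    by blast
  have linB: "linear (B ^^ i)" for i by (rule linear_funpow[OF \<open>linear B\<close>])
  have B_pow: "norm ((B ^^ i) x) \<le> L ^ i * norm x" for i x
  proof (induction i)
    case (Suc i)
    have "norm ((B ^^ Suc i) x) \<le> L * norm ((B ^^ i) x)" using B_le by simp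
    also have "\<dots> \<le> L * (L ^ i * norm x)" using Suc \<open>L \<ge> 1\<close> by (intro mult_left_mono) auto
    finally show ?case by simp
  qed simp
  define a where "a j i = (B ^^ i) (u (j + i))" for j i
  define d where "d j i = a j (Suc i) - a j i" for j i
  have d: "norm (d j i) \<le> e / 4 * (1 / 2) ^ i" for j i
  proof -
    have "d j i = - (B ^^ i) (u (j + i) - B (u (Suc (j + i))))"
      by (simp add: d_def a_def linear_diff[OF linB] funpow_swap1)
    then have "norm (d j i) \<le> L ^ i * norm (u (j + i) - B (u (Suc (j + i))))"
      using B_pow by simp
    also have "\<dots> \<le> L ^ i * \<epsilon> (j + i)"
      using u[of "j + i"] \<open>L \<ge> 1\<close> by (intro mult_left_mono) auto
    also have "\<dots> \<le> L ^ i * \<epsilon> i"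
    proof -
      have "(2 * L) ^ i \<le> (2 * L) ^ (j + i)"
        using \<open>L \<ge> 1\<close> by (intro power_increasing) auto
      then show ?thesis
        unfolding \<epsilon>_def using \<open>L \<ge> 1\<close> \<open>e > 0\<close> by (intro mult_left_mono divide_left_mono) auto
    qed
    also have "\<dots> = e / 4 * (1 / 2) ^ i"
      using \<open>L \<ge> 1\<close> by (simp add: \<epsilon>_def power_mult_distrib power_divide)
    finally show ?thesis .
  qed
  have sm: "summable (\<lambda>i. e / 4 * (1 / 2 :: real) ^ i)"
    by (intro summable_mult summable_geometric) simp
  have sd: "summable (\<lambda>i. norm (d j i))" for j
    by (rule summable_comparison_test'[OF sm, of 0]) (use d in auto)
  define w where "w j = a j 0 + (\<Sum>i. d j i)" for j
  have lim: "a j \<longlonglongrightarrow> w j" for j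
  proof -
    have "(\<lambda>n. a j 0 + (\<Sum>i<n. d j i)) \<longlonglongrightarrow> w j"
      unfolding w_def by (intro tendsto_intros summable_LIMSEQ summable_norm_cancel[OF sd])
    moreover have "a j 0 + (\<Sum>i<n. d j i) = a j n" for n
      unfolding d_def by (subst sum_lessThan_telescope) simp
    ultimately show ?thesis by simp
  qed
  have blB: "bounded_linear B"
    using bounded_linear_of_linear_le[OF \<open>linear B\<close> B_le] .
  \<comment> \<open>Applying \<open>B\<close> to the sequence for \<open>Suc j\<close> gives the
    sequence for \<open>j\<close> shifted by one, so the two limits agree.\<close>
  have "w j = B (w (Suc j))" for j
  proof -
    have "(\<lambda>i. B (a (Suc j) i)) \<longlonglongrightarrow> B (w (Suc j))"
      by (rule bounded_linear.tendsto[OF blB lim])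
    moreover have "B (a (Suc j) i) = a j (Suc i)" for i
      by (simp add: a_def)
    moreover have "(\<lambda>i. a j (Suc i)) \<longlonglongrightarrow> w j"
      using lim by (rule LIMSEQ_Suc)
    ultimately show ?thesis using LIMSEQ_unique by auto
  qed
  moreover have "norm (w 0 - z) < e"
  proof -
    have "norm (w 0 - z) = norm (\<Sum>i. d 0 i)" by (simp add: w_def a_def u0)
    also have "\<dots> \<le> (\<Sum>i. norm (d 0 i))" by (rule summable_norm[OF sd])
    also have "\<dots> \<le> (\<Sum>i. e / 4 * (1 / 2) ^ i)" by (rule suminf_le[OF d sd sm])
    also have "\<dots> = e / 2"
      by (subst suminf_mult) (auto simp: suminf_geometric)
    also have "\<dots> < e" using \<open>e > 0\<close> by simp
    finally show ?thesis .
  qed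
  ultimately show thesis using that by blast
qed

context regular_contraction
begin

text \<open>The time \<open>n\<close> is split into halves: one half is spent on the newest factor
  \<open>I - T\<close>, the other on the induction hypothesis, so the rates multiply.\<close>

lemma decay_power:
  "\<exists>K\<ge>0. \<forall>n y. norm ((T ^^ n) (((\<lambda>x. x - T x) ^^ k) y)) \<le> K * norm y / real (Suc n) powr (real k * s)"
proof (induction k)
  case 0
  then show ?case using norm_pow_le by (intro exI[of _ 1]) auto
next
  case (Suc k)
  define B where "B = (\<lambda>x. x - T x)"
  obtain K where K: "K \<ge> 0"
    "\<And>n y. norm ((T ^^ n) ((B ^^ k) y)) \<le> K * norm y / real (Suc n) powr (real k * s)"
    using Suc unfolding B_def by blast
  define K' where "K' = C * 2 powr s * (K * 2 powr (real k * s))"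
  have "norm ((T ^^ n) ((B ^^ Suc k) y)) \<le> K' * norm y / real (Suc n) powr (real (Suc k) * s)" for n y
  proof -
    define a where "a = n div 2"
    define b where "b = n - a"
    have ab: "n = a + b" by (simp add: a_def b_def)
    have "Suc n \<le> 2 * Suc a" "Suc n \<le> 2 * Suc b" unfolding a_def b_def by presburger+
    then have "real (Suc n) \<le> real (2 * Suc a)" "real (Suc n) \<le> real (2 * Suc b)"
      unfolding of_nat_le_iff by auto
    then have ab2: "real (Suc n) / 2 \<le> real (Suc a)" "real (Suc n) / 2 \<le> real (Suc b)" by simp_all
    \<comment> \<open>Returning from half the time to the full time \<open>n\<close> costs only the
      constant \<open>2 powr t\<close>.\<close>
    have half: "c / real (Suc m) powr t \<le> c * 2 powr t / real (Suc n) powr t"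
      if "real (Suc n) / 2 \<le> real (Suc m)" "c \<ge> 0" "t \<ge> 0" for c t :: real and m
    proof -
      have "(real (Suc n) / 2) powr t \<le> real (Suc m) powr t"
        using that by (intro powr_mono2) auto
      then have "c / real (Suc m) powr t \<le> c / (real (Suc n) / 2) powr t"
        using that by (intro divide_left_mono) auto
      then show ?thesis by (simp add: powr_divide)
    qed
    have "(T ^^ n) ((B ^^ Suc k) y) = (T ^^ a) (B ((T ^^ b) ((B ^^ k) y)))"
      by (simp add: B_def pow_diff pow_pow ab funpow_swap1)
    then have "norm ((T ^^ n) ((B ^^ Suc k) y)) \<le> C * norm ((T ^^ b) ((B ^^ k) y)) / real (Suc a) powr s"
      using decay unfolding B_def by simp
    also have "\<dots> \<le> C * norm ((T ^^ b) ((B ^^ k) y)) * 2 powr s / real (Suc n) powr s"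
      using C_nonneg s_pos ab2 by (intro half) auto
    also have "\<dots> \<le> C * (K * norm y * 2 powr (real k * s) / real (Suc n) powr (real k * s)) * 2 powr s / real (Suc n) powr s"
    proof (intro divide_right_mono mult_right_mono mult_left_mono)
      have "norm ((T ^^ b) ((B ^^ k) y)) \<le> K * norm y / real (Suc b) powr (real k * s)"
        by (rule K)
      also have "\<dots> \<le> K * norm y * 2 powr (real k * s) / real (Suc n) powr (real k * s)"
        using K(1) s_pos ab2 by (intro half) auto
      finally show "norm ((T ^^ b) ((B ^^ k) y)) \<le> \<dots>" .
    qed (use C_nonneg in auto)
    also have "\<dots> = K' * norm y / (real (Suc n) powr (real k * s) * real (Suc n) powr s)"
      by (simp add: K'_def mult_ac)
    also have "real (Suc n) powr (real k * s) * real (Suc n) powr s = real (Suc n) powr (real (Suc k) * s)"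
      by (simp add: powr_add[symmetric] algebra_simps)
    finally show ?thesis .
  qed
  moreover have "K' \<ge> 0" using K C_nonneg by (simp add: K'_def)
  ultimately show ?case unfolding B_def by blast
qed

text \<open>A backward orbit of \<open>I - T\<close> starting near \<open>x - P x\<close> puts its
  initial vector in the range of every power of \<open>I - T\<close>, where each polynomial rate is
  available; adding \<open>P x\<close> returns to a neighbourhood of \<open>x\<close>.\<close>

lemma fast_approximation:
  assumes "e > 0"
  obtains y where "norm (y - x) < e"
    and "\<And>k. \<exists>K. \<forall>n. norm ((T ^^ n) y - P y) \<le> K / real (Suc n) ^ k"
proof -
  define B where "B = (\<lambda>x. x - T x)"
  have linB: "linear B"
    unfolding B_def by (rule linear_compose_sub[OF linear_ident lin])
  have B_le: "norm (B v) \<le> 2 * norm v" for v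
    unfolding B_def using norm_triangle_ineq4[of v "T v"] contr[of v] by linarith
  have dense: "\<exists>y\<in>Z. norm (z - B y) < e" if ze: "z \<in> Z" "e > 0" for z e
  proof -
    obtain y where "dist (y - T y) z < e"
      using ze unfolding Z_def closure_approachable by blast
    then have y: "dist (B y) z < e" by (simp add: B_def)
    \<comment> \<open>Removing the fixed part moves the preimage into \<open>Z\<close> without
      changing its image, so \<open>B\<close> maps \<open>Z\<close> densely into \<open>Z\<close>
      and the approximation can be iterated.\<close>
    have "B (y - P y) = B y"
      by (simp add: B_def linear_diff[OF lin] T_P)
    with y diff_P_in_Z[of y] show ?thesis
      by (metis dist_norm norm_minus_commute)
  qed
  obtain w where w0: "norm (w 0 - (x - P x)) < e" and w: "\<And>j. w j = B (w (Suc j))"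
    using dense_backward_orbit[OF linB B_le one_le_numeral dense diff_P_in_Z[of x] assms] by blast
  have w_iter: "w 0 = (B ^^ k) (w k)" for k
  proof (induction k)
    case (Suc k)
    then show ?case using w[of k] by (simp add: funpow_swap1)
  qed simp
  define y where "y = P x + w 0"
  have "P (w 0) = 0"
    using w[of 0] range_subset_Z P_Z by (simp add: B_def)
  then have diff: "(T ^^ n) y - P y = (T ^^ n) (w 0)" for n
    unfolding y_def
    by (simp add: linear_add[OF lin_pow] linear_add[OF lin_P] pow_fixed T_P P_fixed)
  have "\<exists>K. \<forall>n. norm ((T ^^ n) y - P y) \<le> K / real (Suc n) ^ k" for k
  proof -
    \<comment> \<open>Each factor \<open>I - T\<close> gains only the exponent \<open>s\<close>, so
      about \<open>k / s\<close> of them yield order \<open>k\<close>.\<close>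
    obtain j :: nat where j: "real k / s \<le> real j" using real_arch_simple by blast
    then have js: "real k \<le> real j * s" using s_pos by (simp add: field_simps)
    obtain K where K: "K \<ge> 0"
      "\<And>n y. norm ((T ^^ n) ((B ^^ j) y)) \<le> K * norm y / real (Suc n) powr (real j * s)"
      using decay_power[of j] unfolding B_def by blast
    have "norm ((T ^^ n) y - P y) \<le> K * norm (w j) / real (Suc n) ^ k" for n
    proof -
      have "norm ((T ^^ n) y - P y) \<le> K * norm (w j) / real (Suc n) powr (real j * s)"
        unfolding diff w_iter[of j] by (rule K)
      also have "\<dots> \<le> K * norm (w j) / real (Suc n) powr real k"
        using K(1) js by (intro divide_left_mono powr_mono) auto
      finally show ?thesis by (simp only: powr_realpow of_nat_0_less_iff zero_less_Suc)
    qed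
    then show ?thesis by blast
  qed
  moreover have "norm (y - x) < e" using w0 by (simp add: y_def algebra_simps)
  ultimately show thesis using that by blast
qed

end

section \<open>Norming functionals\<close>

text \<open>Homogeneity is stated as an inequality, which is easy to verify for infima; equality
  follows by applying it with \<open>1 / t\<close>.\<close>

definition sublinear :: "('a::real_normed_vector \<Rightarrow> real) \<Rightarrow> bool" where
  "sublinear p \<longleftrightarrow> p 0 = 0 \<and> (\<forall>x y. p (x + y) \<le> p x + p y) \<and> (\<forall>t>0. \<forall>x. p (t *\<^sub>R x) \<le> t * p x)"

lemma sublinear_scale:
  assumes "sublinear p" and "t \<ge> 0"
  shows "p (t *\<^sub>R x) = t * p x"
proof (cases "t = 0")
  case True
  then show ?thesis using assms by (simp add: sublinear_def)
next
  case False
  then have "t > 0" using assms by simp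
  then have "p (t *\<^sub>R x) \<le> t * p x" using assms by (simp add: sublinear_def)
  moreover have "p ((1 / t) *\<^sub>R (t *\<^sub>R x)) \<le> 1 / t * p (t *\<^sub>R x)"
    using assms \<open>t > 0\<close> unfolding sublinear_def by (metis zero_less_divide_1_iff)
  then have "t * p x \<le> p (t *\<^sub>R x)" using \<open>t > 0\<close> by (simp add: field_simps)
  ultimately show ?thesis by simp
qed

lemma sublinear_minus: "sublinear p \<Longrightarrow> - p (- x) \<le> p x"
proof -
  assume "sublinear p"
  then have "p 0 = 0" "p (x + - x) \<le> p x + p (- x)" unfolding sublinear_def by blast+
  then show ?thesis by simp
qed

text \<open>Take the infimum over nonnegative \<open>t\<close> of
  \<open>p (x + t u) - t p u\<close>. Subadditivity bounds it below by \<open>- p (- x)\<close>;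
  \<open>t = 0\<close> gives domination by \<open>p\<close>, and \<open>t = 1\<close> gives the
  value at \<open>- u\<close>.\<close>

lemma sublinear_shift:
  assumes p: "sublinear p"
  obtains p' where "sublinear p'" and "\<And>x. p' x \<le> p x" and "p' (- u) \<le> - p u"
proof -
  define g where "g x t = p (x + t *\<^sub>R u) - t * p u" for x t
  define p' where "p' x = (INF t\<in>{0..}. g x t)" for x
  have add: "p (x + y) \<le> p x + p y" for x y using p by (simp add: sublinear_def)
  have lower: "- p (- x) \<le> g x t" if "t \<ge> 0" for x t
  proof -
    have "t * p u = p (t *\<^sub>R u)" using sublinear_scale[OF p that] by simp
    also have "\<dots> \<le> p (x + t *\<^sub>R u) + p (- x)" using add[of "x + t *\<^sub>R u" "- x"] by simp
    finally show ?thesis by (simp add: g_def)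
  qed
  have p'_le: "p' x \<le> g x t" if "t \<ge> 0" for x t
    unfolding p'_def using that lower by (intro cINF_lower bdd_belowI2[where m = "- p (- x)"]) auto
  have p'_ge: "c \<le> p' x" if "\<And>t. t \<ge> 0 \<Longrightarrow> c \<le> g x t" for c x
    unfolding p'_def using that by (intro cINF_greatest) auto
  have "p' x \<le> p x" for x using p'_le[of 0 x] by (simp add: g_def)
  moreover have "p' (- u) \<le> - p u"
    using p'_le[of 1 "- u"] p by (simp add: g_def sublinear_def)
  moreover have "sublinear p'"
    unfolding sublinear_def
  proof (intro conjI allI impI)
    show "p' 0 = 0"
      using p'_le[of 0 0] p'_ge[of 0 0] lower[of _ 0] p by (simp add: g_def sublinear_def)
    show "p' (x + y) \<le> p' x + p' y" for x y
    proof -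
      have "p' (x + y) \<le> g x s + g y t" if "s \<ge> 0" "t \<ge> 0" for s t
      proof -
        have "p' (x + y) \<le> g (x + y) (s + t)" using that by (intro p'_le) auto
        also have "\<dots> \<le> g x s + g y t"
          using add[of "x + s *\<^sub>R u" "y + t *\<^sub>R u"] by (simp add: g_def algebra_simps)
        finally show ?thesis .
      qed
      then have "p' (x + y) - g x s \<le> p' y" if "s \<ge> 0" for s
        using that by (intro p'_ge) (simp add: algebra_simps)
      then have "p' (x + y) - p' y \<le> p' x"
        by (intro p'_ge) (simp add: algebra_simps)
      then show ?thesis by simp
    qed
    show "p' (a *\<^sub>R x) \<le> a * p' x" if "a > 0" for a x
    proof -
      have "p' (a *\<^sub>R x) / a \<le> g x t" if "t \<ge> 0" for t
      proof -
        have "p' (a *\<^sub>R x) \<le> g (a *\<^sub>R x) (a * t)" using that \<open>a > 0\<close> by (intro p'_le) auto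
        also have "\<dots> = a * g x t"
          using sublinear_scale[OF p, of a "x + t *\<^sub>R u"] \<open>a > 0\<close>
          by (simp add: g_def algebra_simps)
        finally show ?thesis using \<open>a > 0\<close> by (simp add: field_simps)
      qed
      then have "p' (a *\<^sub>R x) / a \<le> p' x" by (rule p'_ge)
      then show ?thesis using \<open>a > 0\<close> by (simp add: field_simps)
    qed
  qed
  ultimately show thesis using that by blast
qed

text \<open>A sublinear functional that is minimal in the pointwise order is linear, because
  shifting it in a direction \<open>u\<close> would otherwise decrease it.\<close>

lemma ex_linear_le_sublinear:
  fixes p :: "'a::real_normed_vector \<Rightarrow> real"
  assumes p: "sublinear p"
  obtains f where "linear f" and "\<And>x. f x \<le> p x"
proof -
  define A where "A = {q. sublinear q \<and> (\<forall>x. q x \<le> p x)}"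
  have "\<exists>m\<in>A. \<forall>a\<in>A. a \<le> m \<longrightarrow> a = m"
  proof (rule predicate_Zorn)
    \<comment> \<open>Zorn's lemma is applied to the reversed order, so upper bounds of chains are
      pointwise infima and a maximal element is a minimal functional.\<close>
    show "partial_order_on A (relation_of (\<lambda>a b. b \<le> a) A)"
      by (rule partial_order_on_relation_ofI) auto
  next
    fix \<C> assume "\<C> \<in> Chains (relation_of (\<lambda>a b. b \<le> a) A)"
    then have C: "\<C> \<subseteq> A" and tot: "\<And>a b. a \<in> \<C> \<Longrightarrow> b \<in> \<C> \<Longrightarrow> a \<le> b \<or> b \<le> a"
      by (auto simp: Chains_def relation_of_def)
    show "\<exists>u\<in>A. \<forall>a\<in>\<C>. u \<le> a"
    proof (cases "\<C> = {}")
      case True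
      then show ?thesis using p by (auto simp: A_def)
    next
      case False
      define u where "u x = (INF q\<in>\<C>. q x)" for x
      have lower: "- p (- x) \<le> q x" if "q \<in> \<C>" for q x
      proof -
        have "q (- x) \<le> p (- x)" "- q (- x) \<le> q x"
          using that C sublinear_minus by (auto simp: A_def)
        then show ?thesis by linarith
      qed
      have u_le: "u x \<le> q x" if "q \<in> \<C>" for q x
        unfolding u_def using that lower by (intro cINF_lower bdd_belowI2[where m = "- p (- x)"]) auto
      have u_ge: "c \<le> u x" if "\<And>q. q \<in> \<C> \<Longrightarrow> c \<le> q x" for c x
        unfolding u_def using that False by (intro cINF_greatest) auto
      have sub: "sublinear q" "q x \<le> p x" if "q \<in> \<C>" for q x
        using that C by (auto simp: A_def)
      obtain q0 where q0: "q0 \<in> \<C>" using False by blast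
      have "sublinear u"
        unfolding sublinear_def
      proof (intro conjI allI impI)
        have "q 0 = 0" if "q \<in> \<C>" for q using sub(1)[OF that] by (simp add: sublinear_def)
        then show "u 0 = 0" using u_le[OF q0, of 0] u_ge[of 0 0] q0 by fastforce
        show "u (x + y) \<le> u x + u y" for x y
        proof -
          have "u (x + y) \<le> q1 x + q2 y" if q12: "q1 \<in> \<C>" "q2 \<in> \<C>" for q1 q2
          proof -
            \<comment> \<open>Totality of the chain supplies one functional below both, which is
              what makes the infimum subadditive.\<close>
            obtain q where q: "q \<in> \<C>" "q \<le> q1" "q \<le> q2"
              using tot[OF q12] q12 by blast
            have "u (x + y) \<le> q (x + y)" by (rule u_le[OF q(1)])
            also have "\<dots> \<le> q x + q y" using sub(1)[OF q(1)] by (simp add: sublinear_def)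
            also have "\<dots> \<le> q1 x + q2 y" using q by (intro add_mono) (auto simp: le_fun_def)
            finally show ?thesis .
          qed
          then have "u (x + y) - q1 x \<le> q2 y" if "q1 \<in> \<C>" "q2 \<in> \<C>" for q1 q2
            using that by (simp add: diff_le_eq add.commute)
          then have "u (x + y) - q1 x \<le> u y" if "q1 \<in> \<C>" for q1
            using that by (intro u_ge)
          then have "u (x + y) - u y \<le> q1 x" if "q1 \<in> \<C>" for q1
            using that by (simp add: diff_le_eq add.commute)
          then have "u (x + y) - u y \<le> u x"
            by (intro u_ge)
          then show ?thesis by simp
        qed
        show "u (t *\<^sub>R x) \<le> t * u x" if "t > 0" for t x
        proof -
          have "u (t *\<^sub>R x) / t \<le> q x" if "q \<in> \<C>" for q
            using u_le[OF that, of "t *\<^sub>R x"] sublinear_scale[OF sub(1)[OF that], of t x] \<open>t > 0\<close>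
            by (simp add: field_simps)
          then have "u (t *\<^sub>R x) / t \<le> u x" by (rule u_ge)
          then show ?thesis using \<open>t > 0\<close> by (simp add: field_simps)
        qed
      qed
      moreover have "u x \<le> p x" for x
        using u_le[OF q0] sub(2)[OF q0] order_trans by blast
      ultimately show ?thesis using u_le by (auto simp: A_def le_fun_def)
    qed
  qed
  then obtain f where "f \<in> A" and min: "\<forall>a\<in>A. a \<le> f \<longrightarrow> a = f" by blast
  then have f: "sublinear f" "f x \<le> p x" for x by (auto simp: A_def)
  have minimal: "q = f" if "sublinear q" "\<And>x. q x \<le> f x" for q
  proof -
    have "q x \<le> p x" for x using that(2)[of x] f(2)[of x] by (rule order_trans)
    then have "q \<in> A" using that(1) by (simp add: A_def)
    then show ?thesis using min that(2) by (auto simp: le_fun_def)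
  qed
  have neg: "f (- u) = - f u" for u
  proof -
    obtain q where "sublinear q" "\<And>x. q x \<le> f x" "q (- u) \<le> - f u"
      using sublinear_shift[OF f(1)] by blast
    with minimal have "f (- u) \<le> - f u" by blast
    with sublinear_minus[OF f(1), of u] show ?thesis by simp
  qed
  have "linear f"
  proof (rule linearI)
    have add: "f (x + y) \<le> f x + f y" for x y using f(1) by (simp add: sublinear_def)
    show "f (x + y) = f x + f y" for x y
      using add[of x y] add[of "x + y" "- y"] by (simp add: neg)
    show "f (r *\<^sub>R x) = r *\<^sub>R f x" for r x
      using sublinear_scale[OF f(1), of r x] sublinear_scale[OF f(1), of "- r" x] neg[of "r *\<^sub>R x"]
      by (cases "r \<ge> 0") auto
  qed
  with f that show thesis by blast
qed

text \<open>A linear functional below the norm shifted in direction \<open>u\<close> is at most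
  \<open>- norm u\<close> at \<open>- u\<close>, hence at least \<open>norm u\<close> at
  \<open>u\<close>; domination by the norm gives equality.\<close>

lemma norming_functional:
  fixes u :: "'a::real_normed_vector"
  obtains f where "linear f" and "\<And>x. \<bar>f x\<bar> \<le> norm x" and "f u = norm u"
proof -
  have "sublinear (norm :: 'a \<Rightarrow> real)"
    by (auto simp: sublinear_def norm_triangle_ineq)
  then obtain p where p: "sublinear p" "\<And>x. p x \<le> norm x" "p (- u) \<le> - norm u"
    using sublinear_shift by blast
  obtain f where f: "linear f" "\<And>x. f x \<le> p x"
    using ex_linear_le_sublinear[OF p(1)] by blast
  have le: "f x \<le> norm x" for x using f(2)[of x] p(2)[of x] by linarith
  have abs: "\<bar>f x\<bar> \<le> norm x" for x
    using le[of x] le[of "- x"] linear_neg[OF f(1), of x] by simp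
  moreover have "f u = norm u"
    using abs[of u] f(2)[of "- u"] p(3) linear_neg[OF f(1), of u] by simp
  ultimately show thesis using f(1) that by blast
qed

section \<open>Arbitrarily slow orbits\<close>

context regular_contraction
begin

text \<open>Otherwise \<open>I - T\<close> is bounded below on the closed subspace \<open>Z\<close>,
  so its image of \<open>Z\<close> is complete. That image is the whole range, because
  \<open>I - T\<close> annihilates the fixed part of each vector.\<close>

lemma approximate_fixed_vector:
  assumes "\<not> closed (range (\<lambda>x. x - T x))" and "e > 0"
  obtains z where "z \<in> Z" and "norm z = 1" and "norm (z - T z) \<le> e"
proof (rule ccontr)
  assume none: "\<not> thesis"
  note result = that
  define B where "B = (\<lambda>x. x - T x)"
  have linB: "linear B"
    unfolding B_def by (rule linear_compose_sub[OF linear_ident lin])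
  have lower: "e * norm z \<le> norm (B z)" if "z \<in> Z" for z
  proof (cases "z = 0")
    case True
    then show ?thesis by simp
  next
    case False
    define y where "y = z /\<^sub>R norm z"
    have "y \<in> Z" "norm y = 1"
      using that False by (auto simp: y_def subspace_scale[OF subspace_Z])
    then have "\<not> norm (y - T y) \<le> e" using none result by blast
    moreover have "y - T y = B z /\<^sub>R norm z"
      unfolding y_def using linear_cmul[OF linB, of "inverse (norm z)" z] by (simp add: B_def)
    ultimately show ?thesis using False by (simp add: field_simps)
  qed
  have "bounded_linear B"
    unfolding B_def by (intro bounded_linear_sub bounded_linear_ident bl)
  then have "complete (B ` Z)"
    using complete_isometric_image[OF \<open>e > 0\<close> subspace_Z, of B] lower closed_Z
    by (simp add: complete_eq_closed)
  moreover have "B x \<in> B ` Z" for x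
  proof -
    have "B (x - P x) = B x" by (simp add: B_def linear_diff[OF lin] T_P)
    then show ?thesis using diff_P_in_Z by (metis image_eqI)
  qed
  then have "range B = B ` Z" by auto
  ultimately show False using assms(1) by (simp add: complete_eq_closed B_def)
qed

section \<open>Almost invariant vectors and functionals\<close>

lemma norm_pow_diff_le: "norm (x - (T ^^ n) x) \<le> real n * norm (x - T x)"
proof (induction n)
  case (Suc n)
  have "x - (T ^^ Suc n) x = (x - (T ^^ n) x) + (T ^^ n) (x - T x)"
    by (simp add: pow_diff funpow_swap1)
  then have "norm (x - (T ^^ Suc n) x) \<le> norm (x - (T ^^ n) x) + norm ((T ^^ n) (x - T x))"
    using norm_triangle_ineq by metis
  with Suc norm_pow_le[of n "x - T x"] show ?case by (simp add: algebra_simps)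
qed simp

text \<open>This is the Cesaro mean multiplied by \<open>a\<close>; the division is postponed to the
  functional built from it.\<close>

definition orbit_sum :: "nat \<Rightarrow> 'a \<Rightarrow> 'a" where
  "orbit_sum a x = (\<Sum>i<a. (T ^^ i) x)"

lemma linear_orbit_sum: "linear (orbit_sum a)"
  unfolding orbit_sum_def by (intro linear_compose_sum ballI lin_pow)

lemma norm_orbit_sum_le: "norm (orbit_sum a x) \<le> real a * norm x"
proof -
  have "norm (orbit_sum a x) \<le> (\<Sum>i<a. norm x)"
    unfolding orbit_sum_def by (intro order_trans[OF norm_sum] sum_mono norm_pow_le)
  then show ?thesis by simp
qed

text \<open>On \<open>y - T y\<close> the sum telescopes to two terms, so the bound does not grow
  with \<open>a\<close> and becomes small after averaging.\<close>

lemma norm_orbit_sum_diff_le: "norm (orbit_sum a (x - (T ^^ n) x)) \<le> 2 * real n * norm x"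
proof (induction n)
  case 0
  then show ?case by (simp add: linear_0[OF linear_orbit_sum])
next
  case (Suc n)
  define y where "y = (T ^^ n) x"
  have "orbit_sum a (y - T y) = (\<Sum>i<a. (T ^^ i) y - (T ^^ Suc i) y)"
    unfolding orbit_sum_def by (intro sum.cong refl) (simp add: pow_diff funpow_swap1)
  also have "\<dots> = y - (T ^^ a) y" by (subst sum_lessThan_telescope') simp
  finally have "norm (orbit_sum a (y - T y)) \<le> 2 * norm x"
    using norm_triangle_ineq4[of y "(T ^^ a) y"] norm_pow_le[of a y] norm_pow_le[of n x]
    by (simp add: y_def)
  moreover have "orbit_sum a (x - (T ^^ Suc n) x) = orbit_sum a (x - y) + orbit_sum a (y - T y)"
    by (simp add: y_def flip: linear_add[OF linear_orbit_sum])
  ultimately show ?case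
    using Suc norm_triangle_ineq[of "orbit_sum a (x - y)" "orbit_sum a (y - T y)"]
    by (simp add: y_def algebra_simps)
qed

lemma norm_pow_diff_pow_le:
  "norm ((T ^^ n) (x - (T ^^ p) x)) \<le> real p * C * norm x / real (Suc n) powr s"
proof -
  have "(T ^^ n) (x - (T ^^ p) x) = (T ^^ n) x - (T ^^ p) ((T ^^ n) x)"
    by (simp add: pow_diff pow_pow add.commute)
  also have "norm \<dots> \<le> real p * norm ((T ^^ n) x - T ((T ^^ n) x))"
    by (rule norm_pow_diff_le)
  also have "(T ^^ n) x - T ((T ^^ n) x) = (T ^^ n) (x - T x)"
    by (simp add: pow_diff funpow_swap1)
  also have "real p * norm \<dots> \<le> real p * (C * norm x / real (Suc n) powr s)"
    by (intro mult_left_mono decay) auto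
  finally show ?thesis by simp
qed

text \<open>The last clause is the adjoint counterpart of \<open>u \<in> Z\<close>: the functional
  composed with \<open>T ^^ n\<close> tends to \<open>0\<close> in norm. Its constant
  \<open>K\<close> may depend on the pair.\<close>

definition almost_invariant_pair :: "nat \<Rightarrow> real \<Rightarrow> 'a \<Rightarrow> ('a \<Rightarrow> real) \<Rightarrow> bool" where
  "almost_invariant_pair m \<tau> u f \<longleftrightarrow>
     u \<in> Z \<and> norm u \<le> 1 \<and> linear f \<and> (\<forall>x. \<bar>f x\<bar> \<le> 2 * norm x) \<and> f u \<ge> 1 / 2 \<and>
     (\<forall>n\<le>m. norm (u - (T ^^ n) u) \<le> \<tau>) \<and>
     (\<forall>n\<le>m. \<forall>x. \<bar>f (x - (T ^^ n) x)\<bar> \<le> \<tau> * norm x) \<and>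
     (\<exists>K. \<forall>n x. \<bar>f ((T ^^ n) x)\<bar> \<le> K * norm x / real (Suc n) powr s)"

text \<open>Take \<open>f x = \<psi> (A (x - T^p x))\<close> with \<open>\<psi>\<close> a norming functional of \<open>u\<close>: the
  Cesaro mean \<open>A\<close> makes \<open>f\<close> almost \<open>T\<close>-invariant, while the factor \<open>I - T^p\<close>, which hardly
  affects \<open>f u\<close> once \<open>T^p u\<close> is small, makes \<open>f \<circ> T^n\<close> tend to \<open>0\<close> in norm.\<close>

lemma ex_almost_invariant_pair:
  assumes nc: "\<not> closed (range (\<lambda>x. x - T x))" and "\<tau> > 0"
  obtains u f where "almost_invariant_pair m \<tau> u f"
proof -
  \<comment> \<open>The choices are nested: \<open>a\<close> makes the average invariant up to
    \<open>\<tau>\<close> for \<open>m\<close> steps, \<open>u\<close> is then almost fixed even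
    over \<open>a\<close> steps, and finally \<open>p\<close> is a time at which \<open>u\<close>
    has died out.\<close>
  obtain a :: nat where a: "4 * real m / \<tau> \<le> real a" "a \<ge> 1"
  proof -
    obtain a' :: nat where "4 * real m / \<tau> \<le> real a'" using real_arch_simple by blast
    then show thesis by (intro that[of "Suc a'"]) auto
  qed
  define e where "e = min (\<tau> / real (Suc m)) (1 / (4 * real a))"
  have e: "e > 0" "e \<le> \<tau> / real (Suc m)" "e \<le> 1 / (4 * real a)"
    using \<open>\<tau> > 0\<close> a by (auto simp: e_def)
  obtain u where u: "u \<in> Z" "norm u = 1" "norm (u - T u) \<le> e"
    using approximate_fixed_vector[OF nc e(1)] by blast
  obtain \<psi> where psi: "linear \<psi>" "\<And>x. \<bar>\<psi> x\<bar> \<le> norm x" "\<psi> u = norm u"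
    using norming_functional[of u] by blast
  have "eventually (\<lambda>p. norm ((T ^^ p) u) < 1 / 4) sequentially"
    using tendsto_norm_zero[OF pow_tendsto_0[OF u(1)]] by (rule order_tendstoD) simp
  then obtain p where p: "norm ((T ^^ p) u) < 1 / 4"
    using eventually_happens by fastforce
  define f where "f x = \<psi> (orbit_sum a (x - (T ^^ p) x)) / real a" for x
  have lin_f: "linear f"
  proof -
    have "linear (\<lambda>x. x - (T ^^ p) x)" by (rule linear_compose_sub[OF linear_ident lin_pow])
    then have "linear (\<psi> \<circ> (orbit_sum a \<circ> (\<lambda>x. x - (T ^^ p) x)))"
      by (intro linear_compose linear_orbit_sum psi(1))
    then have "linear (\<lambda>x. (1 / real a) *\<^sub>R (\<psi> \<circ> (orbit_sum a \<circ> (\<lambda>x. x - (T ^^ p) x))) x)"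
      by (rule linear_compose_scale_right)
    then show ?thesis by (simp add: f_def[abs_def] o_def)
  qed
  have f_le: "\<bar>f x\<bar> \<le> norm (x - (T ^^ p) x)" for x
    using order_trans[OF psi(2) norm_orbit_sum_le[of a "x - (T ^^ p) x"]] a
    by (simp add: f_def field_simps)
  have two: "norm (x - (T ^^ p) x) \<le> 2 * norm x" for x
    using norm_triangle_ineq4[of x "(T ^^ p) x"] norm_pow_le[of p x] by simp
  \<comment> \<open>The average over the first \<open>a\<close> steps is at least
    \<open>3 / 4\<close>, and subtracting the contribution of \<open>T^p u\<close> loses at most
    \<open>1 / 4\<close>.\<close>
  have f_half: "f u \<ge> 1 / 2"
  proof -
    have "\<psi> ((T ^^ i) u) \<ge> 3 / 4" if "i < a" for i
    proof -
      have "norm (u - (T ^^ i) u) \<le> real i * norm (u - T u)" by (rule norm_pow_diff_le)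
      also have "\<dots> \<le> real a * e" using that u e by (intro mult_mono) auto
      also have "\<dots> \<le> 1 / 4" using e(3) a(2) by (simp add: field_simps)
      finally have "\<bar>\<psi> (u - (T ^^ i) u)\<bar> \<le> 1 / 4" using psi(2) order_trans by blast
      moreover have "\<psi> (u - (T ^^ i) u) = 1 - \<psi> ((T ^^ i) u)"
        using psi(3) u(2) by (simp add: linear_diff[OF psi(1)])
      ultimately show ?thesis by linarith
    qed
    then have "(\<Sum>i<a. 3 / 4) \<le> (\<Sum>i<a. \<psi> ((T ^^ i) u))" by (intro sum_mono) auto
    then have 1: "real a * (3 / 4) \<le> \<psi> (orbit_sum a u)"
      by (simp add: orbit_sum_def linear_sum[OF psi(1)])
    have "\<bar>\<psi> (orbit_sum a ((T ^^ p) u))\<bar> \<le> real a * norm ((T ^^ p) u)"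
      by (rule order_trans[OF psi(2) norm_orbit_sum_le])
    also have "\<dots> \<le> real a * (1 / 4)" using p by (intro mult_left_mono) auto
    finally have 2: "\<psi> (orbit_sum a ((T ^^ p) u)) \<le> real a * (1 / 4)" by linarith
    have "real a * (1 / 2) \<le> \<psi> (orbit_sum a (u - (T ^^ p) u))"
      using 1 2 by (simp add: linear_diff[OF linear_orbit_sum] linear_diff[OF psi(1)])
    then show ?thesis using a(2) by (simp add: f_def field_simps)
  qed
  have u_inv: "norm (u - (T ^^ n) u) \<le> \<tau>" if "n \<le> m" for n
  proof -
    have "norm (u - (T ^^ n) u) \<le> real n * norm (u - T u)" by (rule norm_pow_diff_le)
    also have "\<dots> \<le> real (Suc m) * e" using that u e by (intro mult_mono) auto
    also have "\<dots> \<le> \<tau>" using e(2) by (simp add: field_simps)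
    finally show ?thesis .
  qed
  have f_inv: "\<bar>f (x - (T ^^ n) x)\<bar> \<le> \<tau> * norm x" if "n \<le> m" for n x
  proof -
    define y where "y = x - (T ^^ p) x"
    have "(x - (T ^^ n) x) - (T ^^ p) (x - (T ^^ n) x) = y - (T ^^ n) y"
      by (simp add: y_def pow_diff pow_pow add.commute algebra_simps)
    then have "\<bar>f (x - (T ^^ n) x)\<bar> = \<bar>\<psi> (orbit_sum a (y - (T ^^ n) y))\<bar> / real a"
      by (simp add: f_def)
    also have "\<dots> \<le> (2 * real n * norm y) / real a"
      by (intro divide_right_mono order_trans[OF psi(2) norm_orbit_sum_diff_le]) auto
    also have "\<dots> \<le> (2 * real m * (2 * norm x)) / real a"
      using that two[of x] by (intro divide_right_mono mult_mono) (auto simp: y_def)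
    also have "\<dots> = 4 * real m / real a * norm x" by simp
    also have "\<dots> \<le> \<tau> * norm x"
      using a \<open>\<tau> > 0\<close> by (intro mult_right_mono) (auto simp: field_simps)
    finally show ?thesis .
  qed
  have "\<bar>f ((T ^^ n) x)\<bar> \<le> real p * C * norm x / real (Suc n) powr s" for n x
  proof -
    have "\<bar>f ((T ^^ n) x)\<bar> \<le> norm ((T ^^ n) x - (T ^^ p) ((T ^^ n) x))" by (rule f_le)
    also have "(T ^^ n) x - (T ^^ p) ((T ^^ n) x) = (T ^^ n) (x - (T ^^ p) x)"
      by (simp add: pow_diff pow_pow add.commute)
    finally show ?thesis using norm_pow_diff_pow_le order_trans by blast
  qed
  then have "almost_invariant_pair m \<tau> u f"
    unfolding almost_invariant_pair_def
    using u lin_f order_trans[OF f_le two] f_half u_inv f_inv by auto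
  then show thesis by (rule that)
qed

text \<open>Given finitely many pairs, all demands on the next time hold for every sufficiently
  large \<open>n\<close>, since the earlier vectors and functionals die out. A pair almost invariant
  up to that time is then chosen.\<close>

lemma ex_almost_invariant_sequence:
  fixes r :: "nat \<Rightarrow> real" and \<tau> \<rho> :: "nat \<Rightarrow> real"
  assumes nc: "\<not> closed (range (\<lambda>x. x - T x))"
    and \<tau>: "\<And>k. \<tau> k > 0" and \<rho>: "\<And>k. \<rho> k > 0"
    and r: "r \<longlonglongrightarrow> 0" and r0: "\<And>n. r n \<le> \<rho> 0"
  obtains m u f where "m 0 = 0" and "strict_mono m"
    and "\<And>k. almost_invariant_pair (m k) (\<tau> k) (u k) (f k)"
    and "\<And>k n. n \<ge> m k \<Longrightarrow> r n \<le> \<rho> k"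
    and "\<And>j k n. j < k \<Longrightarrow> n \<ge> m k \<Longrightarrow> norm ((T ^^ n) (u j)) \<le> \<tau> k"
    and "\<And>j k n x. j < k \<Longrightarrow> n \<ge> m k \<Longrightarrow> \<bar>f j ((T ^^ n) x)\<bar> \<le> \<tau> k * norm x"
proof -
  define Q where "Q g k c \<longleftrightarrow>
      (k = 0 \<longrightarrow> fst c = 0) \<and> (\<forall>j<k. fst (g j) < fst c) \<and>
      almost_invariant_pair (fst c) (\<tau> k) (fst (snd c)) (snd (snd c)) \<and>
      (\<forall>n\<ge>fst c. r n \<le> \<rho> k) \<and>
      (\<forall>n\<ge>fst c. \<forall>j<k. norm ((T ^^ n) (fst (snd (g j)))) \<le> \<tau> k) \<and>
      (\<forall>n\<ge>fst c. \<forall>j<k. \<forall>x. \<bar>snd (snd (g j)) ((T ^^ n) x)\<bar> \<le> \<tau> k * norm x)"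
    for g :: "nat \<Rightarrow> nat \<times> 'a \<times> ('a \<Rightarrow> real)" and k c
  have "\<exists>g. \<forall>k. Q g k (g k)"
  proof (rule dependent_wellorder_choice)
    show "Q g k c = Q g' k c" if "\<And>j. j < k \<Longrightarrow> g j = g' j" for c g g' k
      using that by (simp add: Q_def)
  next
    fix k and g :: "nat \<Rightarrow> nat \<times> 'a \<times> ('a \<Rightarrow> real)"
    assume IH: "\<And>j. j < k \<Longrightarrow> Q g j (g j)"
    define u where "u j = fst (snd (g j))" for j
    define f where "f j = snd (snd (g j))" for j
    have pair: "almost_invariant_pair (fst (g j)) (\<tau> j) (u j) (f j)" if "j < k" for j
      using IH[OF that] by (simp add: Q_def u_def f_def)
    define E where "E n \<longleftrightarrow> r n \<le> \<rho> k \<and> (\<forall>j\<in>{..<k}. fst (g j) < n \<and> norm ((T ^^ n) (u j)) \<le> \<tau> k \<and>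
        (\<forall>x. \<bar>f j ((T ^^ n) x)\<bar> \<le> \<tau> k * norm x))" for n
    have "eventually E sequentially"
      unfolding E_def
    proof (intro eventually_conj eventually_ball_finite ballI finite_lessThan)
      show "eventually (\<lambda>n. r n \<le> \<rho> k) sequentially"
        using order_tendstoD(2)[OF r \<rho>[of k]] by (rule eventually_mono) simp
    next
      fix j assume "j \<in> {..<k}"
      then have j: "j < k" by simp
      show "eventually (\<lambda>n. fst (g j) < n) sequentially" by (rule eventually_gt_at_top)
      have "u j \<in> Z" using pair[OF j] by (simp add: almost_invariant_pair_def)
      then have "eventually (\<lambda>n. norm ((T ^^ n) (u j)) < \<tau> k) sequentially"
        using tendsto_norm_zero[OF pow_tendsto_0] \<tau> by (intro order_tendstoD)
      then show "eventually (\<lambda>n. norm ((T ^^ n) (u j)) \<le> \<tau> k) sequentially"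
        by (rule eventually_mono) simp
      obtain K where K: "\<And>n x. \<bar>f j ((T ^^ n) x)\<bar> \<le> K * norm x / real (Suc n) powr s"
        using pair[OF j] by (auto simp: almost_invariant_pair_def)
      have "eventually (\<lambda>n. K / real (Suc n) powr s < \<tau> k) sequentially"
        using weight_tendsto \<tau> by (rule order_tendstoD)
      then show "eventually (\<lambda>n. \<forall>x. \<bar>f j ((T ^^ n) x)\<bar> \<le> \<tau> k * norm x) sequentially"
      proof (rule eventually_mono, intro allI)
        fix n x assume n: "K / real (Suc n) powr s < \<tau> k"
        have "\<bar>f j ((T ^^ n) x)\<bar> \<le> K / real (Suc n) powr s * norm x" using K[of n x] by simp
        also have "\<dots> \<le> \<tau> k * norm x" using n by (intro mult_right_mono) auto
        finally show "\<bar>f j ((T ^^ n) x)\<bar> \<le> \<tau> k * norm x" .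
      qed
    qed
    then obtain m where m: "\<And>n. n \<ge> m \<Longrightarrow> E n" by (auto simp: eventually_sequentially)
    \<comment> \<open>At the first stage there are no earlier pairs and \<open>r0\<close> bounds
      \<open>r\<close> everywhere, so the time can be \<open>0\<close>; thus every \<open>n\<close>
      lies in some block between consecutive times.\<close>
    define m' where "m' = (if k = 0 then 0 else m)"
    have m': "E n" if "n \<ge> m'" for n
      using m[of n] r0[of n] that by (cases "k = 0") (auto simp: m'_def E_def)
    obtain v h where "almost_invariant_pair m' (\<tau> k) v h"
      using ex_almost_invariant_pair[OF nc \<tau>] by blast
    then have "Q g k (m', v, h)"
      using m' by (auto simp: Q_def E_def m'_def u_def f_def)
    then show "\<exists>c. Q g k c" ..
  qed
  then obtain g where g: "\<And>k. Q g k (g k)" by blast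
  show thesis
  proof (rule that[of "\<lambda>k. fst (g k)" "\<lambda>k. fst (snd (g k))" "\<lambda>k. snd (snd (g k))"])
    show "fst (g 0) = 0" using g[of 0] by (simp add: Q_def)
    show "strict_mono (\<lambda>k. fst (g k))"
    proof (rule strict_monoI)
      show "fst (g j) < fst (g k)" if "j < k" for j k
        using g[of k] that unfolding Q_def by blast
    qed
    show "almost_invariant_pair (fst (g k)) (\<tau> k) (fst (snd (g k))) (snd (snd (g k)))" for k
      using g[of k] unfolding Q_def by blast
    show "r n \<le> \<rho> k" if "fst (g k) \<le> n" for k n
      using g[of k] that unfolding Q_def by blast
    show "norm ((T ^^ n) (fst (snd (g j)))) \<le> \<tau> k" if "j < k" "fst (g k) \<le> n" for j k n
      using g[of k] that unfolding Q_def by blast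
    show "\<bar>snd (snd (g j)) ((T ^^ n) x)\<bar> \<le> \<tau> k * norm x" if "j < k" "fst (g k) \<le> n" for j k n x
      using g[of k] that unfolding Q_def by blast
  qed
qed

text \<open>For \<open>n\<close> between \<open>m j\<close> and \<open>m (j + 1)\<close> the pairs with index above \<open>j\<close> still
  contribute about \<open>f i (u i)\<close>, those below \<open>j\<close> have died out, and only the pair with
  index \<open>j\<close> is in transition and out of control.\<close>

lemma pairing_lower_bound:
  assumes mono: "strict_mono m" and dec: "decseq \<tau>" and \<tau>_le: "\<And>k. \<tau> k \<le> 1 / 8"
    and pair: "\<And>k. almost_invariant_pair (m k) (\<tau> k) (u k) (f k)"
    and small_u: "\<And>j k n. j < k \<Longrightarrow> n \<ge> m k \<Longrightarrow> norm ((T ^^ n) (u j)) \<le> \<tau> k"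
    and small_f: "\<And>j k n x. j < k \<Longrightarrow> n \<ge> m k \<Longrightarrow> \<bar>f j ((T ^^ n) x)\<bar> \<le> \<tau> k * norm x"
    and n: "m j \<le> n" "n < m (Suc j)"
  shows "f k ((T ^^ n) (u i)) \<ge>
    - 5 * \<tau> j + (if k = i then (if i < j then 0 else if i = j then - 2 else 1 / 4) else 0)"
proof -
  have u: "norm (u i) \<le> 1" and f_lin: "linear (f i)"
    and f_le: "\<bar>f i x\<bar> \<le> 2 * norm x" and f_half: "f i (u i) \<ge> 1 / 2"
    and u_inv: "n \<le> m i \<Longrightarrow> norm (u i - (T ^^ n) (u i)) \<le> \<tau> i"
    and f_inv: "n \<le> m i \<Longrightarrow> \<bar>f i (x - (T ^^ n) x)\<bar> \<le> \<tau> i * norm x" for i n x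
    using pair[of i] by (auto simp: almost_invariant_pair_def)
  have \<tau>_mono: "\<tau> b \<le> \<tau> a" if "a \<le> b" for a b using dec that by (simp add: decseq_def)
  have \<tau>_nonneg: "\<tau> k \<ge> 0" for k using u_inv[of 0 k] by simp
  have later: "n \<le> m b" if "j < b" for b
  proof -
    have "m (Suc j) \<le> m b" using mono that by (simp add: strict_mono_less_eq)
    then show ?thesis using n by simp
  qed
  consider "i < j" | "i = j" "k = j" | "i \<ge> j" "k < j" | "i = k" "i > j" | "j \<le> k" "k < i" | "j \<le> i" "i < k"
    by linarith
  then show ?thesis
  proof cases
    case 1
    then have "\<bar>f k ((T ^^ n) (u i))\<bar> \<le> 2 * \<tau> j"
      using f_le[of k "(T ^^ n) (u i)"] small_u[OF 1 n(1)] by simp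
    then show ?thesis using 1 \<tau>_nonneg[of j] by auto
  next
    case 2
    have "\<bar>f k ((T ^^ n) (u i))\<bar> \<le> 2"
      using f_le[of k "(T ^^ n) (u i)"] norm_pow_le[of n "u i"] u[of i] by simp
    then show ?thesis using 2 \<tau>_nonneg[of j] by auto
  next
    case 3
    have "\<bar>f k ((T ^^ n) (u i))\<bar> \<le> \<tau> j * norm (u i)" by (rule small_f[OF 3(2) n(1)])
    also have "\<dots> \<le> \<tau> j * 1" using \<tau>_nonneg u by (intro mult_left_mono) auto
    finally show ?thesis using 3 \<tau>_nonneg[of j] by auto
  next
    \<comment> \<open>Near invariance of \<open>u i\<close> costs \<open>2 \<tau> i\<close>, and the
      bound \<open>1 / 8\<close> on \<open>\<tau>\<close> leaves \<open>1 / 4\<close> of the initial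
      pairing.\<close>
    case 4
    have "\<bar>f i (u i - (T ^^ n) (u i))\<bar> \<le> 2 * \<tau> i"
      using f_le[of i "u i - (T ^^ n) (u i)"] u_inv[OF later[OF 4(2)]] by simp
    then have "f i ((T ^^ n) (u i)) \<ge> 1 / 2 - 2 * \<tau> i"
      using f_half[of i] by (simp add: linear_diff[OF f_lin])
    then show ?thesis using 4 \<tau>_le[of i] \<tau>_nonneg[of j] by auto
  next
    \<comment> \<open>Both times \<open>n\<close> and \<open>m i\<close> leave \<open>u i\<close>
      almost unmoved, so the pairing is compared with time \<open>m i\<close>, when
      \<open>f k\<close> has died out. The errors \<open>4 \<tau> i\<close> and
      \<open>\<tau> i\<close> make the constant \<open>5\<close>.\<close>
    case 5
    then have i: "j < i" by simp
    have "\<bar>f k ((T ^^ m i) (u i))\<bar> \<le> \<tau> i * norm (u i)" by (rule small_f[OF 5(2)]) simp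
    also have "\<dots> \<le> \<tau> i * 1" using \<tau>_nonneg u by (intro mult_left_mono) auto
    finally have 1: "\<bar>f k ((T ^^ m i) (u i))\<bar> \<le> \<tau> i" by simp
    have "norm ((T ^^ n) (u i) - (T ^^ m i) (u i)) \<le> 2 * \<tau> i"
      using norm_triangle_ineq4[of "u i - (T ^^ m i) (u i)" "u i - (T ^^ n) (u i)"]
        u_inv[of "m i" i] u_inv[OF later[OF i]] by simp
    then have "\<bar>f k ((T ^^ n) (u i) - (T ^^ m i) (u i))\<bar> \<le> 4 * \<tau> i"
      using f_le[of k "(T ^^ n) (u i) - (T ^^ m i) (u i)"] by simp
    then have "f k ((T ^^ n) (u i)) \<ge> - 5 * \<tau> i"
      using 1 by (simp add: linear_diff[OF f_lin])
    then show ?thesis using 5 \<tau>_mono[of j i] i by simp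
  next
    \<comment> \<open>Dually, \<open>f k\<close> hardly notices a further \<open>m k\<close> steps,
      after which \<open>u i\<close> has died out.\<close>
    case 6
    then have k: "j < k" by simp
    define x where "x = (T ^^ n) (u i)"
    have x: "norm x \<le> 1" unfolding x_def using norm_pow_le u order_trans by blast
    have "norm ((T ^^ m k) x) \<le> \<tau> k"
      unfolding x_def pow_pow by (rule small_u[OF 6(2)]) simp
    then have 1: "\<bar>f k ((T ^^ m k) x)\<bar> \<le> 2 * \<tau> k"
      using f_le[of k "(T ^^ m k) x"] by simp
    have "\<bar>f k (x - (T ^^ m k) x)\<bar> \<le> \<tau> k * norm x" by (rule f_inv) simp
    also have "\<dots> \<le> \<tau> k * 1" using \<tau>_nonneg x by (intro mult_left_mono) auto
    finally have "f k x \<ge> - 3 * \<tau> k" using 1 by (simp add: linear_diff[OF f_lin])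
    then show ?thesis using 6 \<tau>_mono[of j k] \<tau>_nonneg[of j] k by (simp add: x_def)
  qed
qed

end

text \<open>The weights decay so slowly that the tail \<open>\<Sum>i>j. \<theta>^(2 i) / 4\<close> outweighs the
  transitional term \<open>2 \<theta>^(2 j)\<close>.\<close>

lemma weighted_transition_sums:
  fixes j :: nat
  defines "\<gamma> \<equiv> (99 / 100 :: real) ^ 2"
  obtains S where "(\<lambda>i. \<gamma> ^ i * (if i < j then 0 else if i = j then - 2 else 1 / 4)) sums S"
    and "S \<ge> 10 * \<gamma> ^ j"
proof -
  define h :: "nat \<Rightarrow> real" where "h i = \<gamma> ^ i * (if i < j then 0 else if i = j then - 2 else 1 / 4)" for i
  have \<gamma>: "0 < \<gamma>" "\<gamma> < 1" by (simp_all add: \<gamma>_def power2_eq_square)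
  have geom: "(\<lambda>i. \<gamma> ^ Suc j / 4 * \<gamma> ^ i) sums (\<gamma> ^ Suc j / 4 * (1 / (1 - \<gamma>)))"
    using \<gamma> by (intro sums_mult geometric_sums) simp
  have shift: "h (i + Suc j) = \<gamma> ^ Suc j / 4 * \<gamma> ^ i" for i
    by (simp add: h_def power_add)
  have "(\<lambda>i. h (i + Suc j)) sums (\<gamma> ^ Suc j / 4 * (1 / (1 - \<gamma>)))"
    unfolding shift by (rule geom)
  then have "h sums (\<gamma> ^ Suc j / 4 * (1 / (1 - \<gamma>)) + (\<Sum>i<Suc j. h i))"
    by (simp only: sums_iff_shift)
  moreover have "(\<Sum>i<Suc j. h i) = - 2 * \<gamma> ^ j"
    by (simp add: h_def)
  moreover have "\<gamma> ^ Suc j / 4 * (1 / (1 - \<gamma>)) + - 2 * \<gamma> ^ j \<ge> 10 * \<gamma> ^ j"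
  proof -
    \<comment> \<open>The ratio \<open>99 / 100\<close> is close enough to \<open>1\<close> for the
      tail to exceed \<open>12\<close> times the weight at \<open>j\<close>; the transition consumes
      \<open>2\<close> of these.\<close>
    have "12 \<le> \<gamma> / 4 * (1 / (1 - \<gamma>))" by (simp add: \<gamma>_def power2_eq_square)
    then have "12 * \<gamma> ^ j \<le> \<gamma> / 4 * (1 / (1 - \<gamma>)) * \<gamma> ^ j"
      using \<gamma> by (intro mult_right_mono) auto
    then show ?thesis by simp
  qed
  ultimately show thesis using that unfolding h_def by simp
qed

context regular_contraction
begin

text \<open>In the double series for \<open>F (T^n x)\<close> the diagonal has weights
  \<open>\<gamma> ^ i\<close> and contributes at least \<open>10 \<gamma> ^ j\<close> for
  \<open>n\<close> in block \<open>j\<close>; the remaining error is at most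
  \<open>\<gamma> ^ j\<close>, while \<open>r n\<close> does not exceed
  \<open>\<gamma> ^ j\<close>.\<close>

lemma slow_orbit_bounded_by_1:
  fixes r :: "nat \<Rightarrow> real"
  assumes nc: "\<not> closed (range (\<lambda>x. x - T x))"
    and r: "r \<longlonglongrightarrow> 0" and r1: "\<And>n. r n \<le> 1"
  obtains x F where "x \<in> Z" and "bounded_linear F" and "\<And>n. r n \<le> F ((T ^^ n) x)"
proof -
  define \<theta> :: real where "\<theta> = 99 / 100"
  define \<gamma> where "\<gamma> = \<theta> ^ 2"
  \<comment> \<open>Each entry has error at most \<open>5 \<tau> j\<close>, and summing the weights
    \<open>\<theta> ^ i\<close> over rows and columns contributes \<open>100\<close> twice, which
    explains \<open>50000\<close>.\<close>
  define \<tau> where "\<tau> k = \<gamma> ^ k / 50000" for k :: nat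
  have \<theta>: "0 < \<theta>" "\<theta> < 1" by (simp_all add: \<theta>_def)
  have \<gamma>: "0 < \<gamma>" "\<gamma> < 1" by (simp_all add: \<gamma>_def \<theta>_def power2_eq_square)
  have \<gamma>_pow: "\<gamma> ^ k \<le> 1" for k using \<gamma> by (simp add: power_le_one)
  obtain m u f where m0: "m 0 = 0" and mono: "strict_mono m"
    and pair: "\<And>k. almost_invariant_pair (m k) (\<tau> k) (u k) (f k)"
    and r_le: "\<And>k n. n \<ge> m k \<Longrightarrow> r n \<le> \<gamma> ^ k"
    and small_u: "\<And>j k n. j < k \<Longrightarrow> n \<ge> m k \<Longrightarrow> norm ((T ^^ n) (u j)) \<le> \<tau> k"
    and small_f: "\<And>j k n x. j < k \<Longrightarrow> n \<ge> m k \<Longrightarrow> \<bar>f j ((T ^^ n) x)\<bar> \<le> \<tau> k * norm x"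
    using ex_almost_invariant_sequence[OF nc, of \<tau> "\<lambda>k. \<gamma> ^ k" r] r r1 \<gamma>
    unfolding \<tau>_def by auto
  have uZ: "u i \<in> Z" and u1: "norm (u i) \<le> 1" and f_lin: "linear (f i)"
    and f_le: "\<bar>f i x\<bar> \<le> 2 * norm x" for i x
    using pair[of i] by (auto simp: almost_invariant_pair_def)
  have geo: "summable (\<lambda>i. \<theta> ^ i)" and geo_sum: "(\<Sum>i. \<theta> ^ i) = 100"
    using \<theta> by (auto intro: summable_geometric simp: suminf_geometric) (simp add: \<theta>_def)

  have sx: "summable (\<lambda>i. \<theta> ^ i *\<^sub>R u i)"
  proof (rule summable_norm_cancel, rule summable_comparison_test'[OF geo, of 0])
    show "norm (norm (\<theta> ^ i *\<^sub>R u i)) \<le> \<theta> ^ i" for i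
      using mult_left_mono[OF u1[of i], of "\<theta> ^ i"] \<theta> by simp
  qed
  define x where "x = (\<Sum>i. \<theta> ^ i *\<^sub>R u i)"
  have "x \<in> Z"
  proof (rule closed_sequentially[OF closed_Z])
    show "(\<Sum>i<n. \<theta> ^ i *\<^sub>R u i) \<in> Z" for n
      by (intro subspace_sum[OF subspace_Z] subspace_scale[OF subspace_Z] uZ)
    show "(\<lambda>n. \<Sum>i<n. \<theta> ^ i *\<^sub>R u i) \<longlonglongrightarrow> x"
      unfolding x_def by (rule summable_LIMSEQ[OF sx])
  qed

  have sF: "summable (\<lambda>k. \<theta> ^ k * f k y)" for y
  proof (rule summable_comparison_test'[OF summable_mult2[OF geo, of "2 * norm y"], of 0])
    show "norm (\<theta> ^ k * f k y) \<le> \<theta> ^ k * (2 * norm y)" for k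
      using mult_left_mono[OF f_le[of k y], of "\<theta> ^ k"] \<theta> by (simp add: abs_mult)
  qed
  define F where "F y = (\<Sum>k. \<theta> ^ k * f k y)" for y
  have lin_F: "linear F"
  proof (rule linearI)
    show "F (y + z) = F y + F z" for y z
      unfolding F_def suminf_add[OF sF sF] by (simp add: linear_add[OF f_lin] distrib_left)
    show "F (c *\<^sub>R y) = c *\<^sub>R F y" for c y
      unfolding F_def using suminf_mult[OF sF[of y], of c]
      by (simp add: linear_cmul[OF f_lin] mult.left_commute)
  qed
  have bl_F: "bounded_linear F"
  proof (rule bounded_linear_of_linear_le[OF lin_F])
    show "norm (F y) \<le> 200 * norm y" for y
    proof -
      have le: "norm (\<theta> ^ k * f k y) \<le> \<theta> ^ k * (2 * norm y)" for k
        using mult_left_mono[OF f_le[of k y], of "\<theta> ^ k"] \<theta> by (simp add: abs_mult)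
      have s: "summable (\<lambda>k. norm (\<theta> ^ k * f k y))"
        by (rule summable_comparison_test'[OF summable_mult2[OF geo, of "2 * norm y"], of 0]) (use le in simp)
      have "norm (F y) \<le> (\<Sum>k. norm (\<theta> ^ k * f k y))"
        unfolding F_def by (rule summable_norm[OF s])
      also have "\<dots> \<le> (\<Sum>k. \<theta> ^ k * (2 * norm y))"
        by (rule suminf_le[OF le s summable_mult2[OF geo]])
      also have "\<dots> = 200 * norm y"
        using suminf_mult2[OF geo, of "2 * norm y"] geo_sum by simp
      finally show ?thesis .
    qed
  qed

  have "r n \<le> F ((T ^^ n) x)" for n
  proof -
    \<comment> \<open>This is the block containing \<open>n\<close>; the maximum exists because a
      strictly increasing \<open>m\<close> satisfies \<open>k \<le> m k\<close>.\<close>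
    define j where "j = (GREATEST j. m j \<le> n)"
    have ex: "m 0 \<le> n" by (simp add: m0)
    have bound: "k \<le> n" if "m k \<le> n" for k
      using strict_mono_imp_increasing[OF mono, of k] that by linarith
    have j: "m j \<le> n" unfolding j_def by (rule GreatestI_nat[where b = n]) (use ex bound in auto)
    have j': "n < m (Suc j)"
    proof (rule ccontr)
      assume "\<not> n < m (Suc j)"
      then have "Suc j \<le> j"
        unfolding j_def by (intro Greatest_le_nat[where b = n]) (use bound in \<open>auto simp: j_def[symmetric]\<close>)
      then show False by simp
    qed
    define d :: "nat \<Rightarrow> real" where "d i = (if i < j then 0 else if i = j then - 2 else 1 / 4)" for i
    have pairing: "f k ((T ^^ n) (u i)) \<ge> - 5 * \<tau> j + (if k = i then d i else 0)" for k i
    proof -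
      have "decseq \<tau>"
        unfolding decseq_def \<tau>_def using \<gamma> by (auto intro: power_decreasing divide_right_mono)
      moreover have "\<tau> k \<le> 1 / 8" for k using \<gamma>_pow[of k] by (simp add: \<tau>_def)
      ultimately show ?thesis
        unfolding d_def using pairing_lower_bound[OF mono _ _ pair small_u small_f j j'] by blast
    qed
    have F_ge: "F ((T ^^ n) (u i)) \<ge> - 500 * \<tau> j + \<theta> ^ i * d i" for i
    proof -
      have s1: "(\<lambda>k. - 5 * \<tau> j * \<theta> ^ k + (if k = i then \<theta> ^ k * d k else 0)) sums
          (- 5 * \<tau> j * 100 + \<theta> ^ i * d i)"
        using geo_sum summable_sums[OF geo] by (intro sums_add sums_mult sums_single) simp
      have s2: "(\<lambda>k. \<theta> ^ k * f k ((T ^^ n) (u i))) sums F ((T ^^ n) (u i))"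
        unfolding F_def by (rule summable_sums[OF sF])
      have le: "- 5 * \<tau> j * \<theta> ^ k + (if k = i then \<theta> ^ k * d k else 0) \<le> \<theta> ^ k * f k ((T ^^ n) (u i))" for k
      proof -
        have "\<theta> ^ k * (- 5 * \<tau> j + (if k = i then d i else 0)) \<le> \<theta> ^ k * f k ((T ^^ n) (u i))"
          using pairing \<theta> by (intro mult_left_mono) auto
        then show ?thesis by (cases "k = i") (simp_all add: algebra_simps)
      qed
      show ?thesis using sums_le[OF le s1 s2] by simp
    qed
    obtain S where S: "(\<lambda>i. \<gamma> ^ i * d i) sums S" "S \<ge> 10 * \<gamma> ^ j"
      using weighted_transition_sums[of j] unfolding d_def \<gamma>_def \<theta>_def by blast
    have "bounded_linear (\<lambda>y. F ((T ^^ n) y))"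
      by (rule bounded_linear_compose[OF bl_F bl_pow])
    from bounded_linear.sums[OF this summable_sums[OF sx]]
    have "(\<lambda>i. F ((T ^^ n) (\<theta> ^ i *\<^sub>R u i))) sums F ((T ^^ n) x)"
      by (simp add: x_def)
    then have s2: "(\<lambda>i. \<theta> ^ i * F ((T ^^ n) (u i))) sums F ((T ^^ n) x)"
      by (simp add: linear_cmul[OF lin_pow] linear_cmul[OF lin_F])
    have s1: "(\<lambda>i. - 500 * \<tau> j * \<theta> ^ i + \<gamma> ^ i * d i) sums (- 500 * \<tau> j * 100 + S)"
      using geo_sum summable_sums[OF geo] S by (intro sums_add sums_mult) simp_all
    have le: "- 500 * \<tau> j * \<theta> ^ i + \<gamma> ^ i * d i \<le> \<theta> ^ i * F ((T ^^ n) (u i))" for i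
    proof -
      have "\<theta> ^ i * (- 500 * \<tau> j + \<theta> ^ i * d i) \<le> \<theta> ^ i * F ((T ^^ n) (u i))"
        using F_ge \<theta> by (intro mult_left_mono) auto
      moreover have "\<gamma> ^ i = \<theta> ^ i * \<theta> ^ i"
        by (simp add: \<gamma>_def power2_eq_square power_mult_distrib)
      ultimately show ?thesis by (simp add: algebra_simps)
    qed
    have "- 500 * \<tau> j * 100 + S \<le> F ((T ^^ n) x)"
      by (rule sums_le[OF le s1 s2])
    moreover have "r n \<le> \<gamma> ^ j" by (rule r_le[OF j])
    moreover have "\<gamma> ^ j > 0" using \<gamma> by simp
    ultimately show ?thesis using S(2) by (simp add: \<tau>_def)
  qed
  with \<open>x \<in> Z\<close> bl_F show thesis by (rule that)
qed

lemma slow_orbit: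
  fixes r :: "nat \<Rightarrow> real"
  assumes "\<not> closed (range (\<lambda>x. x - T x))" and "r \<longlonglongrightarrow> 0"
  obtains x F where "x \<in> Z" and "bounded_linear F" and "\<And>n. r n \<le> F ((T ^^ n) x)"
proof -
  have "Bseq r" using assms(2) by (intro convergent_imp_Bseq convergentI)
  then obtain B where B: "B > 0" "\<And>n. norm (r n) \<le> B" by (auto elim: BseqE)
  have lim: "(\<lambda>n. r n / B) \<longlonglongrightarrow> 0"
    using tendsto_divide[OF assms(2) tendsto_const[of B]] B by simp
  have le: "r n / B \<le> 1" for n using B(1) B(2)[of n] by simp
  show thesis
  proof (rule slow_orbit_bounded_by_1[OF assms(1) lim le])
    fix x F assume xF: "x \<in> Z" "bounded_linear F" "\<And>n. r n / B \<le> F ((T ^^ n) x)"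
    show thesis
    proof (rule that)
      show "x \<in> Z" by (rule xF(1))
      show "bounded_linear (\<lambda>y. B * F y)"
        using xF(2) by (rule bounded_linear_const_mult)
      show "r n \<le> B * F ((T ^^ n) x)" for n
        using xF(3)[of n] B(1) by (simp add: field_simps)
    qed
  qed
qed

end

section \<open>The complex theorem\<close>

lemma bounded_clinear_iff:
  fixes f :: "'a::complex_normed_vector \<Rightarrow> 'b::complex_normed_vector"
  shows "bounded_clinear f \<longleftrightarrow> bounded_linear f \<and> (\<forall>c x. f (c *\<^sub>C x) = c *\<^sub>C f x)"
  unfolding bounded_clinear_def Vector_Spaces.linear_iff
  using vector_space_scaleC[where 'a = 'a] vector_space_scaleC[where 'a = 'b]
  by (auto simp: linear_add[OF bounded_linear.linear])

lemma csubspace_iff: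
  fixes S :: "'a::complex_normed_vector set"
  shows "csubspace S \<longleftrightarrow> 0 \<in> S \<and> (\<forall>x\<in>S. \<forall>y\<in>S. x + y \<in> S) \<and> (\<forall>c. \<forall>x\<in>S. c *\<^sub>C x \<in> S)"
  by (rule module.subspace_def) (simp add: module_iff_vector_space vector_space_scaleC)

lemma bounded_linear_scaleC: "bounded_linear ((*\<^sub>C) c :: 'a::complex_normed_vector \<Rightarrow> 'a)"
proof (rule bounded_linear_intro)
  fix r and x :: 'a
  show "c *\<^sub>C (r *\<^sub>R x) = r *\<^sub>R (c *\<^sub>C x)"
    by (simp add: scaleR_scaleC scaleC_scaleC mult.commute)
  show "norm (c *\<^sub>C x) \<le> norm x * cmod c" by (simp add: norm_scaleC mult.commute)
qed (rule scaleC_add_right)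

lemma scaleC_diff_right: "c *\<^sub>C (x - y) = c *\<^sub>C x - c *\<^sub>C (y :: 'a::complex_normed_vector)"
  by (rule linear_diff[OF bounded_linear.linear[OF bounded_linear_scaleC]])

text \<open>The usual formula \<open>F x - i F (i x)\<close> lets the slow orbits be found with real
  functionals and transferred at the end.\<close>

lemma bounded_clinear_complexification:
  fixes F :: "'a::complex_normed_vector \<Rightarrow> real"
  assumes "bounded_linear F"
  obtains \<phi> :: "'a \<Rightarrow> complex" where "bounded_clinear \<phi>" and "\<And>x. Re (\<phi> x) = F x"
proof -
  define \<phi> where "\<phi> x = complex_of_real (F x) - \<i> * complex_of_real (F (\<i> *\<^sub>C x))" for x
  have lin: "linear F" using assms by (rule bounded_linear.linear)
  have "bounded_linear \<phi>"
    unfolding \<phi>_def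
    by (intro bounded_linear_sub bounded_linear_const_mult bounded_linear_compose[OF bounded_linear_of_real]
        bounded_linear_compose[OF assms] bounded_linear_scaleC bounded_linear_ident)
  moreover have "\<phi> (c *\<^sub>C x) = c *\<^sub>C \<phi> x" for c x
  proof -
    have "c = complex_of_real (Re c) + complex_of_real (Im c) * \<i>"
      by (simp add: complex_eq_iff)
    then have split: "c *\<^sub>C x = Re c *\<^sub>R x + Im c *\<^sub>R (\<i> *\<^sub>C x)"
      unfolding scaleR_scaleC scaleC_scaleC scaleC_add_left[symmetric] by simp
    have "\<i> * c = complex_of_real (Re c) * \<i> + complex_of_real (- Im c)"
      by (simp add: complex_eq_iff)
    then have "\<i> *\<^sub>C (c *\<^sub>C x) = Re c *\<^sub>R (\<i> *\<^sub>C x) + (- Im c) *\<^sub>R x"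
      unfolding scaleR_scaleC scaleC_scaleC scaleC_add_left[symmetric] by simp
    then have "F (\<i> *\<^sub>C (c *\<^sub>C x)) = Re c * F (\<i> *\<^sub>C x) - Im c * F x"
      by (simp only: linear_add[OF lin] linear_cmul[OF lin]) simp
    moreover have "F (c *\<^sub>C x) = Re c * F x + Im c * F (\<i> *\<^sub>C x)"
      by (simp only: split linear_add[OF lin] linear_cmul[OF lin]) simp
    ultimately show ?thesis
      by (simp add: \<phi>_def scaleC_complex_def complex_eq_iff algebra_simps)
  qed
  ultimately have "bounded_clinear \<phi>" by (simp add: bounded_clinear_iff)
  moreover have "Re (\<phi> x) = F x" for x by (simp add: \<phi>_def)
  ultimately show thesis by (rule that)
qed

lemma comp_upto_closed:
  assumes "Q id" and "\<And>f g. Q f \<Longrightarrow> Q g \<Longrightarrow> Q (f \<circ> g)"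
    and "\<And>i. i \<in> {1..N} \<Longrightarrow> Q (Ps i)" and "n \<le> N"
  shows "Q (comp_upto Ps n)"
  using assms(4) by (induction n) (simp_all add: assms)

lemma superpolynomially_fast_atI:
  assumes "\<And>k. \<exists>K. \<forall>n. norm (S n x) \<le> K / real (Suc n) ^ k"
  shows "superpolynomially_fast_at S x"
  unfolding superpolynomially_fast_at_def
proof (intro allI impI landau_o.smallI)
  fix k :: nat and c :: real assume "c > 0"
  \<comment> \<open>One power more than required turns the bound into little-o.\<close>
  obtain K where K: "\<And>n. norm (S n x) \<le> K / real (Suc n) ^ Suc k" using assms by blast
  obtain n0 :: nat where n0: "\<bar>K\<bar> / c \<le> real n0" using real_arch_simple by blast
  have "norm (norm (S n x)) \<le> c * norm (1 / real n ^ k)" if "n \<ge> max n0 1" for n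
  proof -
    have n: "real n > 0" "\<bar>K\<bar> \<le> c * real n"
      using that n0 \<open>c > 0\<close> by (auto simp: field_simps intro: order_trans[OF _ mult_left_mono])
    have "norm (S n x) \<le> \<bar>K\<bar> / real (Suc n) ^ Suc k"
      using K[of n] by (rule order_trans) (intro divide_right_mono, auto)
    also have "\<dots> \<le> \<bar>K\<bar> / real n ^ Suc k"
      using n by (intro divide_left_mono power_mono mult_pos_pos zero_less_power) auto
    also have "\<dots> \<le> c * real n / real n ^ Suc k"
      using n by (intro divide_right_mono) auto
    also have "\<dots> = c * (1 / real n ^ k)" using n by simp
    finally show ?thesis by simp
  qed
  then show "eventually (\<lambda>n. norm (norm (S n x)) \<le> c * norm (1 / real n ^ k)) sequentially"
    unfolding eventually_sequentially by blast
qed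

lemma csubspace_superpolynomially_fast:
  fixes S :: "nat \<Rightarrow> 'a::complex_normed_vector \<Rightarrow> 'a"
  assumes "\<And>n. bounded_clinear (S n)"
  shows "csubspace {x. superpolynomially_fast_at S x}"
proof -
  have lin: "linear (S n)" and sc: "S n (c *\<^sub>C x) = c *\<^sub>C S n x" for n c x
    using assms[of n] by (auto simp: bounded_clinear_iff dest: bounded_linear.linear)
  have "superpolynomially_fast_at S 0"
    by (simp add: superpolynomially_fast_at_def linear_0[OF lin])
  moreover have "superpolynomially_fast_at S (x + y)"
    if "superpolynomially_fast_at S x" "superpolynomially_fast_at S y" for x y
    unfolding superpolynomially_fast_at_def
  proof (intro allI impI)
    fix k :: nat assume "k \<ge> 1"
    then have "(\<lambda>n. norm (S n x) + norm (S n y)) \<in> o(\<lambda>n. 1 / real n ^ k)"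
      using that by (intro sum_in_smallo) (auto simp: superpolynomially_fast_at_def)
    moreover have "(\<lambda>n. norm (S n (x + y))) \<in> O(\<lambda>n. norm (S n x) + norm (S n y))"
      by (intro bigoI[of _ 1] always_eventually allI) (simp add: linear_add[OF lin] norm_triangle_ineq)
    ultimately show "(\<lambda>n. norm (S n (x + y))) \<in> o(\<lambda>n. 1 / real n ^ k)"
      by (rule landau_o.big_small_trans[rotated])
  qed
  moreover have "superpolynomially_fast_at S (c *\<^sub>C x)" if "superpolynomially_fast_at S x" for c x
    using that by (simp add: superpolynomially_fast_at_def sc norm_scaleC landau_o.small.cmult_in_iff)
  ultimately show ?thesis by (simp add: csubspace_iff)
qed

theorem theorem4p2:
  fixes Ps :: "nat \<Rightarrow> 'a::complex_banach \<Rightarrow> 'a"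
    and T P :: "'a \<Rightarrow> 'a" and M Z :: "'a set"
    and N :: nat and q :: real
  assumes "q \<ge> 2" and "q_uniformly_convex TYPE('a) q"
    and "N \<ge> 1" and "\<And>i. i \<in> {1..N} \<Longrightarrow> orthoprojection (Ps i)"
    and "T = comp_upto Ps N"
    and "M = (\<Inter>i\<in>{1..N}. range (Ps i))"
    and "Z = closure (range (\<lambda>x. x - T x))"
    and "P = projection_along M Z"
  shows "direct_sum_decomposition M Z \<and>
    orthoprojection P \<and>
    (\<forall>x. (\<lambda>n. norm ((T ^^ n) x - P x)) \<longlonglongrightarrow> 0) \<and>
    (closed (range (\<lambda>x. x - T x)) \<longrightarrow>
      (\<exists>C>0. \<exists>r\<in>{0..<1}. \<forall>n. onorm (\<lambda>x. (T ^^ n) x - P x) \<le> C * r ^ n)) \<and>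
    (\<not> closed (range (\<lambda>x. x - T x)) \<longrightarrow>
      arbitrarily_slow (\<lambda>n x. (T ^^ n) x - P x) \<and>
      weakly_arbitrarily_slow (\<lambda>n x. (T ^^ n) x - P x)) \<and>
    (\<exists>X0. csubspace X0 \<and> closure X0 = UNIV \<and>
      (\<forall>x\<in>X0. superpolynomially_fast_at (\<lambda>n x. (T ^^ n) x - P x) x))"
proof -
  note T_def = assms(5) and M_def = assms(6) and Z_eq = assms(7) and P_def = assms(8)
  have q: "q > 0" "q \<ge> 1" using \<open>q \<ge> 2\<close> by simp_all
  obtain c where c: "c > 0"
    and uc: "\<And>(x::'a) y R. norm x \<le> R \<Longrightarrow> norm y \<le> R \<Longrightarrow> R > 0 \<Longrightarrow>
           c * (norm (x - y) / R) powr q \<le> 1 - norm (x + y) / (2 * R)"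
    using q_uniformly_convex_scaled[OF assms(2)] by blast

  have Ps_bcl: "bounded_clinear (Ps i)" and Ps_idem: "Ps i (Ps i x) = Ps i x"
    and Ps_contr: "norm (Ps i x) \<le> norm x" if i: "i \<in> {1..N}" for i x
  proof -
    have o: "bounded_clinear (Ps i)" "Ps i \<circ> Ps i = Ps i" "onorm (Ps i) \<le> 1"
      using assms(4)[OF i] by (auto simp: orthoprojection_def)
    show "bounded_clinear (Ps i)" by (rule o(1))
    show "Ps i (Ps i x) = Ps i x" using o(2) by (metis comp_apply)
    have "norm (Ps i x) \<le> onorm (Ps i) * norm x"
      using o(1) by (intro onorm) (simp add: bounded_clinear_iff)
    also have "\<dots> \<le> 1 * norm x" using o(3) by (intro mult_right_mono) auto
    finally show "norm (Ps i x) \<le> norm x" by simp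
  qed
  have Ps_lin: "linear (Ps i)" if "i \<in> {1..N}" for i
    using Ps_bcl[OF that] by (auto simp: bounded_clinear_iff dest: bounded_linear.linear)
  have drop: "c * norm (x - Ps i x) powr q \<le> norm x - norm (Ps i x)"
    if "i \<in> {1..N}" "norm x \<le> 1" for i x
    by (rule contractive_projection_norm_drop[OF uc c q(2) Ps_lin Ps_idem Ps_contr that(2)])
      (use that in auto)

  have "bounded_clinear (comp_upto Ps N) \<and> (\<forall>x. norm (comp_upto Ps N x) \<le> norm x)"
  proof (rule comp_upto_closed[where Q = "\<lambda>f. bounded_clinear f \<and> (\<forall>x. norm (f x) \<le> norm x)" and N = N])
    show "bounded_clinear (id :: 'a \<Rightarrow> 'a) \<and> (\<forall>x::'a. norm (id x) \<le> norm x)"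
      by (simp add: bounded_clinear_iff bounded_linear_ident id_def)
    show "bounded_clinear (f \<circ> g) \<and> (\<forall>x. norm ((f \<circ> g) x) \<le> norm x)"
      if "bounded_clinear f \<and> (\<forall>x. norm (f x) \<le> norm x)" "bounded_clinear g \<and> (\<forall>x. norm (g x) \<le> norm x)"
      for f g :: "'a \<Rightarrow> 'a"
      using that by (auto simp: bounded_clinear_iff o_def intro: bounded_linear_compose order_trans)
  qed (use Ps_bcl Ps_contr in auto)
  then have T_bcl: "bounded_clinear T" and T_contr: "norm (T x) \<le> norm x" for x
    by (auto simp: T_def)
  have T_bl: "bounded_linear T" and T_lin: "linear T" and T_sc: "T (a *\<^sub>C x) = a *\<^sub>C T x" for a x
    using T_bcl by (auto simp: bounded_clinear_iff dest: bounded_linear.linear)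

  \<comment> \<open>Fixed space of the product\<close>
  have M_fixed: "M = {x. T x = x}"
  proof (intro equalityI subsetI)
    fix x assume "x \<in> M"
    then have fixed: "Ps i x = x" if "i \<in> {1..N}" for i
      using that Ps_idem by (fastforce simp: M_def)
    have "comp_upto Ps n x = x" if "n \<le> N" for n
      using that by (induction n) (simp_all add: fixed)
    then show "x \<in> {x. T x = x}" by (simp add: T_def)
  next
    fix x assume "x \<in> {x. T x = x}"
    then have x: "T x = x" by simp
    \<comment> \<open>The norm drop is available only in the unit ball, so the fixed point is
      normalised first.\<close>
    define y where "y = x /\<^sub>R norm x"
    have y: "norm y \<le> 1" by (cases "x = 0") (simp_all add: y_def)
    have "T y = y" by (simp add: y_def linear_cmul[OF T_lin] x)
    then have "norm (comp_upto Ps N y) = norm y" by (simp add: T_def)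
    then have fixed: "Ps i y = y" if "i \<in> {1..N}" for i
      using comp_upto_fixed_point[of c q N Ps y N i, OF c q(1) drop Ps_contr y] that by auto
    have "x = norm x *\<^sub>R y" by (cases "x = 0") (simp_all add: y_def)
    then have "Ps i x = x" if "i \<in> {1..N}" for i
      using linear_cmul[OF Ps_lin[OF that], of "norm x" y] fixed[OF that] by simp
    then show "x \<in> M" unfolding M_def by (metis INT_I rangeI)
  qed

  \<comment> \<open>Decay rate and splitting of the space\<close>
  define s where "s = 1 / q"
  define C where "C = real N / c powr s"
  have T_drop: "norm (x - T x) \<le> real N * ((norm x - norm (T x)) / c) powr s" if "norm x \<le> 1" for x
    unfolding T_def s_def
    using comp_upto_norm_drop[of c q N Ps x N, OF c q(1) drop Ps_contr that] by simp
  have decay: "norm ((T ^^ n) (x - T x)) \<le> C * norm x / real (Suc n) powr s" for n x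
    unfolding C_def
    by (rule decay_of_differences[OF T_lin T_contr c]) (use T_drop q in \<open>auto simp: s_def\<close>)

  have subspace_Z: "subspace Z"
    unfolding Z_eq
    by (intro subspace_closure linear_subspace_image subspace_UNIV linear_compose_sub linear_ident T_lin)
  have diff_in_Z: "x - T x \<in> Z" for x
    unfolding Z_eq by (rule subsetD[OF closure_subset rangeI])
  have "\<exists>y. T y = y \<and> x - y \<in> Z" for x
  proof -
    \<comment> \<open>\<open>T\<close> maps the coset of \<open>x\<close> into itself without
      increasing norms, so it must fix the unique element of minimal norm.\<close>
    define S where "S = {y. x - y \<in> Z}"
    have "closed S"
    proof -
      have "S = (\<lambda>y. x - y) -` Z" by (auto simp: S_def)
      moreover have "closed ((\<lambda>y. x - y) -` Z)"
        unfolding Z_eq by (intro continuous_closed_vimage continuous_intros closed_closure)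
      ultimately show ?thesis by simp
    qed
    moreover have "S \<noteq> {}" using subspace_0[OF subspace_Z] by (auto simp: S_def intro: exI[of _ x])
    moreover have "(y + z) /\<^sub>R 2 \<in> S" if "y \<in> S" "z \<in> S" for y z
    proof -
      have "x - (y + z) /\<^sub>R 2 = (1 / 2) *\<^sub>R ((x - y) + (x - z))"
        by (simp add: algebra_simps flip: scaleR_add_left)
      then show ?thesis
        using that by (simp add: S_def subspace_add[OF subspace_Z] subspace_scale[OF subspace_Z])
    qed
    ultimately obtain y where y: "y \<in> S" "\<And>z. z \<in> S \<Longrightarrow> norm z \<le> norm y \<Longrightarrow> z = y"
      using min_norm_element[OF assms(2) q(1), of S] by blast
    have "x - T y = (x - y) + (y - T y)" by simp
    then have "T y \<in> S"
      using y(1) subspace_add[OF subspace_Z _ diff_in_Z, of "x - y" y] by (simp add: S_def)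
    with y T_contr have "T y = y" by blast
    with y(1) show ?thesis by (auto simp: S_def)
  qed
  then obtain P' where P': "\<And>x. T (P' x) = P' x" "\<And>x. x - P' x \<in> Z" by metis

  interpret rc: regular_contraction T P' C s
  proof (rule regular_contraction.intro)
    show "s > 0" "C \<ge> 0" using q c by (auto simp: s_def C_def)
    show "x - P' x \<in> closure (range (\<lambda>x. x - T x))" for x using P' by (simp add: Z_eq)
  qed (use T_lin T_contr decay P' in auto)
  have Z_Z: "rc.Z = Z" by (simp add: rc.Z_def Z_eq)

  have P_eq: "P = P'"
  proof
    fix x
    have "m = P' x" if "m \<in> M" "x - m \<in> Z" for m
    proof -
      have "(x - m) - (x - P' x) \<in> Z" by (rule subspace_diff[OF subspace_Z that(2) P'(2)])
      then have "P' x - m \<in> Z" by simp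
      moreover have "T (P' x - m) = P' x - m"
        using that P' by (simp add: linear_diff[OF T_lin] M_fixed)
      ultimately show ?thesis using rc.fixed_in_Z Z_Z by fastforce
    qed
    then show "P x = P' x"
      unfolding P_def projection_along_def using P' by (intro the_equality) (auto simp: M_fixed)
  qed

  \<comment> \<open>Complex linearity and the conclusions of the theorem\<close>
  have pow_sc: "(T ^^ n) (a *\<^sub>C x) = a *\<^sub>C (T ^^ n) x" for n a x
    by (induction n) (simp_all add: T_sc)
  have P_sc: "P (a *\<^sub>C x) = a *\<^sub>C P x" for a x
  proof -
    have "(\<lambda>n. a *\<^sub>C (T ^^ n) x) \<longlonglongrightarrow> a *\<^sub>C P x"
      unfolding P_eq by (rule bounded_linear.tendsto[OF bounded_linear_scaleC rc.pow_tendsto_P])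
    then show ?thesis
      using LIMSEQ_unique[OF rc.pow_tendsto_P] by (simp add: P_eq pow_sc)
  qed
  have P_bcl: "bounded_clinear P"
    using rc.bl_P P_sc by (simp add: bounded_clinear_iff P_eq)
  define D where "D = (\<lambda>n x. (T ^^ n) x - P x)"
  have D_bcl: "bounded_clinear (D n)" for n
    unfolding bounded_clinear_iff D_def
    using bounded_linear_sub[OF rc.bl_pow rc.bl_P] by (simp add: P_eq[symmetric] pow_sc P_sc scaleC_diff_right)

  have decomposition: "direct_sum_decomposition M Z"
    unfolding direct_sum_decomposition_def
  proof (intro conjI allI)
    have T0: "T 0 = 0" by (rule linear_0[OF T_lin])
    show "csubspace M"
      by (simp add: csubspace_iff M_fixed linear_add[OF T_lin] T_sc T0)
    show "csubspace Z"
      unfolding csubspace_iff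
    proof (intro conjI ballI allI)
      fix a and x assume x: "x \<in> Z"
      have "a *\<^sub>C (y - T y) = a *\<^sub>C y - T (a *\<^sub>C y)" for y
        by (simp add: T_sc scaleC_diff_right)
      then have "(*\<^sub>C) a ` range (\<lambda>x. x - T x) \<subseteq> range (\<lambda>x. x - T x)"
        by (auto intro: range_eqI)
      then have "closure ((*\<^sub>C) a ` range (\<lambda>x. x - T x)) \<subseteq> closure (range (\<lambda>x. x - T x))"
        by (rule closure_mono)
      then have "(*\<^sub>C) a ` closure (range (\<lambda>x. x - T x)) \<subseteq> closure (range (\<lambda>x. x - T x))"
        using closure_bounded_linear_image_subset[OF bounded_linear_scaleC] by (rule order_trans[rotated])
      then show "a *\<^sub>C x \<in> Z" using x by (auto simp: Z_eq)
    qed (use subspace_0 subspace_add subspace_Z in blast)+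
    show "closed M"
      unfolding M_fixed using linear_continuous_on[OF T_bl]
      by (intro closed_Collect_eq continuous_on_id) auto
    show "closed Z" by (simp add: Z_eq)
    show "M \<inter> Z = {0}"
      using rc.fixed_in_Z subspace_0[OF subspace_Z] T0 by (auto simp: M_fixed Z_Z)
    show "\<exists>m\<in>M. \<exists>z\<in>Z. x = m + z" for x
      using P'[of x] by (intro bexI[of _ "P' x"] bexI[of _ "x - P' x"]) (auto simp: M_fixed)
  qed

  have orth: "orthoprojection P"
    unfolding orthoprojection_def
  proof (intro conjI)
    show "P \<circ> P = P" using rc.P_fixed P'(1) by (auto simp: P_eq)
    show "onorm P \<le> 1" by (rule onorm_bound) (simp_all add: P_eq rc.norm_P_le)
  qed (rule P_bcl)

  have conv: "(\<lambda>n. norm ((T ^^ n) x - P x)) \<longlonglongrightarrow> 0" for x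
    using rc.pow_tendsto_P[of x] unfolding P_eq by (intro tendsto_norm_zero LIM_zero)

  have geometric: "\<exists>C>0. \<exists>r\<in>{0..<1}. \<forall>n. onorm (D n) \<le> C * r ^ n"
    if cl: "closed (range (\<lambda>x. x - T x))"
  proof -
    obtain r where r: "r \<in> {0..<1}" "\<And>n x. norm ((T ^^ n) x - P' x) \<le> 4 * r ^ n * norm x"
      using rc.geometric_convergence[OF cl] by blast
    have "onorm (D n) \<le> 4 * r ^ n" for n
      by (rule onorm_bound) (use r in \<open>auto simp: D_def P_eq\<close>)
    with r(1) show ?thesis by (intro exI[of _ 4] conjI bexI[of _ r]) auto
  qed

  have slow: "\<exists>x\<in>Z. \<exists>F. bounded_linear F \<and> (\<forall>n. r n \<le> F (D n x))"
    if nc: "\<not> closed (range (\<lambda>x. x - T x))" and r: "r \<longlonglongrightarrow> 0" for r :: "nat \<Rightarrow> real"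
  proof (rule rc.slow_orbit[OF nc r])
    fix x F assume xF: "x \<in> rc.Z" "bounded_linear F" "\<And>n. r n \<le> F ((T ^^ n) x)"
    \<comment> \<open>The slow vector lies in \<open>Z\<close>, where the limit projection
      vanishes.\<close>
    then have "D n x = (T ^^ n) x" for n using rc.P_Z by (simp add: D_def P_eq)
    with xF show ?thesis by (metis Z_Z)
  qed
  have weak: "weakly_arbitrarily_slow D" if nc: "\<not> closed (range (\<lambda>x. x - T x))"
    unfolding weakly_arbitrarily_slow_def
  proof (intro allI impI)
    fix r :: "nat \<Rightarrow> real" assume "r \<longlonglongrightarrow> 0"
    then obtain x F where xF: "bounded_linear F" "\<And>n. r n \<le> F (D n x)"
      using slow[OF nc] by blast
    obtain \<phi> :: "'a \<Rightarrow> complex" where "bounded_clinear \<phi>" "\<And>x. Re (\<phi> x) = F x"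
      using bounded_clinear_complexification[OF xF(1)] by blast
    with xF(2) show "\<exists>x. \<exists>\<phi> :: 'a \<Rightarrow> complex. bounded_clinear \<phi> \<and> (\<forall>n. Re (\<phi> (D n x)) \<ge> r n)"
      by (intro exI[of _ x] exI[of _ \<phi>]) simp
  qed
  have strong: "arbitrarily_slow D" if nc: "\<not> closed (range (\<lambda>x. x - T x))"
    unfolding arbitrarily_slow_def
  proof (intro allI impI)
    fix r :: "nat \<Rightarrow> real" assume "r \<longlonglongrightarrow> 0"
    then obtain x F where xF: "bounded_linear F" "\<And>n. r n \<le> F (D n x)"
      using slow[OF nc] by blast
    obtain K where K: "K > 0" "\<And>x. norm (F x) \<le> norm x * K"
      using bounded_linear.pos_bounded[OF xF(1)] by blast
    \<comment> \<open>Absorbing the bound \<open>K\<close> of the functional into the vector turns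
      the weak lower bound into one for norms.\<close>
    have "r n \<le> norm (D n (K *\<^sub>R x))" for n
    proof -
      have "linear (D n)" using D_bcl by (auto simp: bounded_clinear_iff dest: bounded_linear.linear)
      then have "norm (D n (K *\<^sub>R x)) = norm (D n x) * K"
        using K(1) by (simp add: linear_cmul)
      with xF(2)[of n] K(2)[of "D n x"] show ?thesis by simp
    qed
    then show "\<exists>x. \<forall>n. norm (D n x) \<ge> r n" by blast
  qed

  \<comment> \<open>The set of all fast vectors serves as \<open>X0\<close>, so only its density
    remains to be shown.\<close>
  have "closure {x. superpolynomially_fast_at D x} = UNIV"
  proof -
    have "x \<in> closure {x. superpolynomially_fast_at D x}" for x
      unfolding closure_approachable
    proof (intro allI impI)
      fix e :: real assume "e > 0"
      then obtain y where y: "norm (y - x) < e"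
        "\<And>k. \<exists>K. \<forall>n. norm ((T ^^ n) y - P' y) \<le> K / real (Suc n) ^ k"
        using rc.fast_approximation by blast
      then have "superpolynomially_fast_at D y"
        by (intro superpolynomially_fast_atI) (simp add: D_def P_eq)
      with y(1) show "\<exists>y\<in>{x. superpolynomially_fast_at D x}. dist y x < e"
        by (auto simp: dist_norm)
    qed
    then show ?thesis by blast
  qed
  with csubspace_superpolynomially_fast[of D, OF D_bcl]
  have "\<exists>X0. csubspace X0 \<and> closure X0 = UNIV \<and> (\<forall>x\<in>X0. superpolynomially_fast_at D x)"
    by blast
  with decomposition orth conv geometric strong weak show ?thesis
    unfolding D_def by blast
qed

end
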